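(* Let $n\ge1$ be an integer and $1\le p<\infty$. The space $\mathcal D_p(\mathbb R^{2n},\Delta_n)$ has infinite covering, Hausdorff, asymptotic, Assouad, and Assouad--Nagata dimension.
   Context: $\mathbb R^{2n}$ carries the Euclidean metric and $\Delta_n=\{(v,v)\in\mathbb R^{2n}:v\in\mathbb R^n\}$. Persistence diagrams on a metric space $(X,d)$ relative to a non-empty closed subset $A$ ($1\le p<\infty$): for a set $Y$, let $\widetilde{\mathcal D}(Y)$ be the set of countable (finite or countably infinite) multisets of elements of $Y$; the sum of two multisets is their disjoint union. For $\widetilde\sigma,\widetilde\tau\in\widetilde{\mathcal D}(X)$ put $\widetilde d_p(\widetilde\sigma,\widetilde\tau)=\inf_\phi\big(\sum_{x\in\widetilde\sigma}d(x,\phi(x))^p\big)^{1/p}$ over all bijections $\phi\colon\widetilde\sigma\to\widetilde\tau$ of multisets ($\inf\varnothing=\infty$). Write $\widetilde\sigma\sim_A\widetilde\tau$ if $\widetilde\sigma+\widetilde\alpha=\widetilde\tau+\widetilde\beta$ for some $\widetilde\alpha,\widetilde\beta\in\widetilde{\mathcal D}(A)$; let $\mathcal D(X,A)=\widetilde{\mathcal D}(X)/\!\sim_A$, with $\sigma$ the class of $\widetilde\sigma$ and $\sigma_\varnothing$ the class of the empty multiset. Put $d_p(\sigma,\tau)=\inf_{\widetilde\alpha,\widetilde\beta\in\widetilde{\mathcal D}(A)}\widetilde d_p(\widetilde\sigma+\widetilde\alpha,\widetilde\tau+\widetilde\beta)$ and $\mathcal D_p(X,A)=\{\sigma: d_p(\sigma,\sigma_\varnothing)<\infty\}$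 with the metric $d_p$. Dimensions of a metric space $M$. Covering dimension: the least $m$ such that every finite open cover of $M$ has an open refinement in which each point belongs to at most $m+1$ members ($\infty$ if none). Hausdorff dimension: the usual one. Asymptotic dimension: the least $m$ such that for every $R>0$ there is a cover of $M$ by sets of uniformly bounded diameter such that every ball of radius $R$ meets at most $m+1$ members ($\infty$ if none). Assouad dimension: the infimum of $s\ge0$ for which there is $C>0$ such that for all $0<r<R$ every ball of radius $R$ can be covered by at most $C(R/r)^s$ balls of radius $r$ ($\infty$ if none). Assouad--Nagata dimension: the least $m$ for which there is $c>0$ such that for every $r>0$ there is a cover of $M$ by sets of diameter at most $cr$ such that every subset of $M$ of diameter at most $r$ meets at most $m+1$ members ($\infty$ if none). *)

theory Defs
  imports "HOL-Analysis.Analysis" "HOL-Library.Extended_Nat"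
begin

section \<open>Countable multisets\<close>

text \<open>A countable multiset is represented by its multiplicity function. A multiplicity may be
  \<open>\<infinity>\<close>, meaning that the point is repeated countably infinitely often.\<close>

type_synonym 'a cmset = "'a \<Rightarrow> enat"

definition cmsets :: "'a set \<Rightarrow> 'a cmset set" where
  "cmsets Y = {\<sigma>. countable {x. \<sigma> x \<noteq> 0} \<and> {x. \<sigma> x \<noteq> 0} \<subseteq> Y}"

definition cm_empty :: "'a cmset" where
  "cm_empty = (\<lambda>x. 0)"

definition cm_add :: "'a cmset \<Rightarrow> 'a cmset \<Rightarrow> 'a cmset"  (infixl "\<oplus>\<^sub>m" 65) where
  "\<sigma> \<oplus>\<^sub>m \<tau> = (\<lambda>x. \<sigma> x + \<tau> x)"

text \<open>The individual points of a multiset: the copies of \<open>x\<close> are the pairs \<open>(x, i)\<close> with \<open>i\<close> below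
  the multiplicity of \<open>x\<close>. Bijections of multisets are bijections between these sets.\<close>

definition cm_points :: "'a cmset \<Rightarrow> ('a \<times> nat) set" where
  "cm_points \<sigma> = {(x, i). enat i < \<sigma> x}"

section \<open>Spaces of persistence diagrams\<close>

text \<open>Real powers on the extended half-line. The value \<open>\<infinity>\<close> at \<open>\<infinity>\<close> is only used for exponents
  \<open>s > 0\<close>; note that \<open>0 powr s = 0\<close> also for \<open>s = 0\<close>.\<close>

definition epowr :: "ennreal \<Rightarrow> real \<Rightarrow> ennreal" where
  "epowr x s = (if x = \<infinity> then \<infinity> else ennreal (enn2real x powr s))"

definition matching_cost ::
    "real \<Rightarrow> 'a::metric_space cmset \<Rightarrow> ('a \<times> nat \<Rightarrow> 'a \<times> nat) \<Rightarrow> ennreal" where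
  "matching_cost p \<sigma> \<phi> = (\<Sum>\<^sub>\<infinity>e\<in>cm_points \<sigma>. ennreal (dist (fst e) (fst (\<phi> e)) powr p))"

definition cm_dist :: "real \<Rightarrow> 'a::metric_space cmset \<Rightarrow> 'a cmset \<Rightarrow> ennreal" where
  "cm_dist p \<sigma> \<tau> =
     (INF \<phi>\<in>{\<phi>. bij_betw \<phi> (cm_points \<sigma>) (cm_points \<tau>)}. epowr (matching_cost p \<sigma> \<phi>) (1 / p))"

definition diagram_rel :: "'a set \<Rightarrow> ('a cmset \<times> 'a cmset) set" where
  "diagram_rel A = {(\<sigma>, \<tau>). \<sigma> \<in> cmsets UNIV \<and> \<tau> \<in> cmsets UNIV \<and>
     (\<exists>\<alpha>\<in>cmsets A. \<exists>\<beta>\<in>cmsets A. \<sigma> \<oplus>\<^sub>m \<alpha> = \<tau> \<oplus>\<^sub>m \<beta>)}"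

definition diagrams :: "'a set \<Rightarrow> 'a cmset set set" where
  "diagrams A = cmsets UNIV // diagram_rel A"

definition empty_diagram :: "'a set \<Rightarrow> 'a cmset set" where
  "empty_diagram A = diagram_rel A `` {cm_empty}"

text \<open>The infimum also runs over the representatives of the two classes; by the lemma
  \<open>diagram_dist_class\<close> below it can be computed with any fixed representatives.\<close>

definition diagram_dist ::
    "real \<Rightarrow> 'a::metric_space set \<Rightarrow> 'a cmset set \<Rightarrow> 'a cmset set \<Rightarrow> ennreal" where
  "diagram_dist p A S T =
     (INF \<sigma>\<in>S. INF \<tau>\<in>T. INF \<alpha>\<in>cmsets A. INF \<beta>\<in>cmsets A. cm_dist p (\<sigma> \<oplus>\<^sub>m \<alpha>) (\<tau> \<oplus>\<^sub>m \<beta>))"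

definition pdiagrams :: "real \<Rightarrow> 'a::metric_space set \<Rightarrow> 'a cmset set set" where
  "pdiagrams p A = {S \<in> diagrams A. diagram_dist p A S (empty_diagram A) < \<infinity>}"

text \<open>On \<open>pdiagrams p A\<close> the distance is finite (triangle inequality through the empty diagram),
  so nothing is lost by reading it as a real number.\<close>

definition pdiagram_dist ::
    "real \<Rightarrow> 'a::metric_space set \<Rightarrow> 'a cmset set \<Rightarrow> 'a cmset set \<Rightarrow> real" where
  "pdiagram_dist p A S T = enn2real (diagram_dist p A S T)"

definition diagonal :: "('v \<times> 'v) set" where
  "diagonal = {(v, v) | v. True}"

subsection \<open>Independence of the representatives\<close>

lemma cm_add_assoc: "(a \<oplus>\<^sub>m b) \<oplus>\<^sub>m c = a \<oplus>\<^sub>m (b \<oplus>\<^sub>m c)"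
  by (simp add: cm_add_def add.assoc)

lemma cm_add_commute: "a \<oplus>\<^sub>m b = b \<oplus>\<^sub>m a"
  by (simp add: cm_add_def add.commute)

lemma cmsets_add: "a \<in> cmsets A \<Longrightarrow> b \<in> cmsets A \<Longrightarrow> a \<oplus>\<^sub>m b \<in> cmsets A"
proof -
  assume a: "a \<in> cmsets A" "b \<in> cmsets A"
  have "{x. (a \<oplus>\<^sub>m b) x \<noteq> 0} \<subseteq> {x. a x \<noteq> 0} \<union> {x. b x \<noteq> 0}"
    by (auto simp: cm_add_def)
  with a show ?thesis
    unfolding cmsets_def by (auto intro: countable_subset)
qed

lemma cm_empty_in: "cm_empty \<in> cmsets A"
  by (simp add: cmsets_def cm_empty_def)

lemma refl_diagram_rel: "\<sigma> \<in> cmsets UNIV \<Longrightarrow> (\<sigma>, \<sigma>) \<in> diagram_rel A"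
  using cm_empty_in by (fastforce simp: diagram_rel_def)

lemma equiv_diagram_rel: "equiv (cmsets UNIV) (diagram_rel A)"
proof (rule equivI)
  show "diagram_rel A \<subseteq> cmsets UNIV \<times> cmsets UNIV"
    by (auto simp: diagram_rel_def)
  show "refl_on (cmsets UNIV) (diagram_rel A)"
    by (auto simp: refl_on_def refl_diagram_rel)
  show "sym (diagram_rel A)"
    by (auto simp: diagram_rel_def intro!: symI) metis
  show "trans (diagram_rel A)"
  proof (rule transI)
    fix a b c :: "'a cmset"
    assume "(a, b) \<in> diagram_rel A" "(b, c) \<in> diagram_rel A"
    then obtain \<alpha> \<beta> \<gamma> \<delta> where
      m: "a \<in> cmsets UNIV" "c \<in> cmsets UNIV" "\<alpha> \<in> cmsets A" "\<beta> \<in> cmsets A"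
         "\<gamma> \<in> cmsets A" "\<delta> \<in> cmsets A"
      and e: "a \<oplus>\<^sub>m \<alpha> = b \<oplus>\<^sub>m \<beta>" "b \<oplus>\<^sub>m \<gamma> = c \<oplus>\<^sub>m \<delta>"
      by (auto simp: diagram_rel_def)
    have "a \<oplus>\<^sub>m (\<alpha> \<oplus>\<^sub>m \<gamma>) = c \<oplus>\<^sub>m (\<delta> \<oplus>\<^sub>m \<beta>)"
    proof -
      have "a \<oplus>\<^sub>m (\<alpha> \<oplus>\<^sub>m \<gamma>) = b \<oplus>\<^sub>m \<gamma> \<oplus>\<^sub>m \<beta>"
        unfolding cm_add_assoc[symmetric] e(1) by (simp add: cm_add_def ac_simps)
      then show ?thesis by (simp add: e(2) cm_add_assoc)
    qed
    with m cmsets_add show "(a, c) \<in> diagram_rel A"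
      unfolding diagram_rel_def by blast
  qed
qed

lemma ex_bij_enat_split:
  "\<exists>g. bij_betw g {i. enat i < a + b} ({i. enat i < a} <+> {i. enat i < b})"
proof (cases "a = \<infinity> \<or> b = \<infinity>")
  case True
  have "countable ({i. enat i < a} <+> {i. enat i < b})"
    by (simp add: Plus_def)
  moreover have "infinite ({i. enat i < a} <+> {i. enat i < b})"
    using True by (auto simp: finite_Plus_iff)
  ultimately have "bij_betw (from_nat_into ({i. enat i < a} <+> {i. enat i < b})) UNIV
                     ({i. enat i < a} <+> {i. enat i < b})"
    by (rule bij_betw_from_nat_into)
  moreover have "{i. enat i < a + b} = UNIV"
    using True by auto
  ultimately show ?thesis by auto
next
  case False
  then obtain m n where "a = enat m" "b = enat n" by auto
  then have e: "{i. enat i < a} = {..<m}" "{i. enat i < b} = {..<n}" "{i. enat i < a + b} = {..<m+n}"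
    by auto
  show ?thesis unfolding e
    by (rule finite_same_card_bij) (simp_all add: card_Plus)
qed

lemma ex_bij_points_split:
  "\<exists>h. bij_betw h (cm_points (\<sigma> \<oplus>\<^sub>m \<gamma>)) (cm_points \<sigma> <+> cm_points \<gamma>) \<and>
     (\<forall>e. case_sum fst fst (h e) = fst e)"
proof -
  obtain g where g: "\<And>a b. bij_betw (g a b) {i. enat i < a + b} ({i. enat i < a} <+> {i. enat i < b})"
    using ex_bij_enat_split by metis
  define h where "h e = map_sum (Pair (fst e)) (Pair (fst e)) (g (\<sigma> (fst e)) (\<gamma> (fst e)) (snd e))"
    for e :: "'a \<times> nat"
  have f: "case_sum fst fst (h e) = fst e" for e
    by (cases "g (\<sigma> (fst e)) (\<gamma> (fst e)) (snd e)") (simp_all add: h_def)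
  have "bij_betw h (cm_points (\<sigma> \<oplus>\<^sub>m \<gamma>)) (cm_points \<sigma> <+> cm_points \<gamma>)"
    unfolding bij_betw_def
  proof
    show "inj_on h (cm_points (\<sigma> \<oplus>\<^sub>m \<gamma>))"
    proof (rule inj_onI)
      fix u v assume u: "u \<in> cm_points (\<sigma> \<oplus>\<^sub>m \<gamma>)" and v: "v \<in> cm_points (\<sigma> \<oplus>\<^sub>m \<gamma>)" and uv: "h u = h v"
      then have 1: "fst u = fst v" using f by metis
      have "inj (map_sum (Pair (fst v)) (Pair (fst v)))"
        by (intro sum.inj_map) (auto intro: injI)
      then have "g (\<sigma> (fst v)) (\<gamma> (fst v)) (snd u) = g (\<sigma> (fst v)) (\<gamma> (fst v)) (snd v)"
        using uv 1 by (auto simp: h_def dest: injD)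
      moreover have "enat (snd u) < \<sigma> (fst v) + \<gamma> (fst v)" "enat (snd v) < \<sigma> (fst v) + \<gamma> (fst v)"
        using u v 1 by (auto simp: cm_points_def cm_add_def)
      ultimately have "snd u = snd v"
        using g[of "\<sigma> (fst v)" "\<gamma> (fst v)"] by (auto simp: bij_betw_def inj_on_def)
      with 1 show "u = v" by (simp add: prod_eq_iff)
    qed
    show "h ` cm_points (\<sigma> \<oplus>\<^sub>m \<gamma>) = cm_points \<sigma> <+> cm_points \<gamma>"
    proof (intro equalityI subsetI)
      fix y assume "y \<in> h ` cm_points (\<sigma> \<oplus>\<^sub>m \<gamma>)"
      then obtain x i where y: "y = h (x, i)" and i: "enat i < \<sigma> x + \<gamma> x"
        by (auto simp: cm_points_def cm_add_def)
      have "g (\<sigma> x) (\<gamma> x) i \<in> {i. enat i < \<sigma> x} <+> {i. enat i < \<gamma> x}"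
        using g[of "\<sigma> x" "\<gamma> x"] i by (auto simp: bij_betw_def)
      then show "y \<in> cm_points \<sigma> <+> cm_points \<gamma>"
        by (auto simp: y h_def cm_points_def)
    next
      fix y assume y: "y \<in> cm_points \<sigma> <+> cm_points \<gamma>"
      then obtain x z where z: "z \<in> {i. enat i < \<sigma> x} <+> {i. enat i < \<gamma> x}"
          and yz: "y = map_sum (Pair x) (Pair x) z"
        by (auto simp: cm_points_def) (metis InlI map_sum.simps(1) mem_Collect_eq,
            metis InrI map_sum.simps(2) mem_Collect_eq)
      obtain i where "enat i < \<sigma> x + \<gamma> x" "z = g (\<sigma> x) (\<gamma> x) i"
        using z g[of "\<sigma> x" "\<gamma> x"] by (auto simp: bij_betw_def) 
      then show "y \<in> h ` cm_points (\<sigma> \<oplus>\<^sub>m \<gamma>)"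
        by (intro image_eqI[of _ _ "(x, i)"]) (auto simp: yz h_def cm_points_def cm_add_def)
    qed
  qed
  with f show ?thesis by blast
qed

lemma bij_betw_map_sum_id:
  assumes "bij_betw f A B"
  shows "bij_betw (map_sum f id) (A <+> C) (B <+> C)"
proof -
  have "map_sum f id ` (A <+> C) = f ` A <+> C"
    unfolding Plus_def by (simp add: image_Un image_image)
  moreover have "inj_on (map_sum f id) (A <+> C)"
    using assms by (auto intro!: inj_onI dest: inj_onD simp: bij_betw_def)
  ultimately show ?thesis
    using assms by (simp add: bij_betw_def)
qed

lemma cm_dist_add_le: "cm_dist p (\<sigma> \<oplus>\<^sub>m \<gamma>) (\<tau> \<oplus>\<^sub>m \<gamma>) \<le> cm_dist p \<sigma> \<tau>"
  unfolding cm_dist_def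
proof (rule INF_mono, clarify)
  fix \<phi> assume \<phi>: "bij_betw \<phi> (cm_points \<sigma>) (cm_points \<tau>)"
  obtain h where h: "bij_betw h (cm_points (\<sigma> \<oplus>\<^sub>m \<gamma>)) (cm_points \<sigma> <+> cm_points \<gamma>)"
      and hf: "\<And>e. case_sum fst fst (h e) = fst e"
    using ex_bij_points_split by metis
  obtain k where k: "bij_betw k (cm_points (\<tau> \<oplus>\<^sub>m \<gamma>)) (cm_points \<tau> <+> cm_points \<gamma>)"
      and kf: "\<And>e. case_sum fst fst (k e) = fst e"
    using ex_bij_points_split by metis
  define k' where "k' = inv_into (cm_points (\<tau> \<oplus>\<^sub>m \<gamma>)) k"
  have k': "bij_betw k' (cm_points \<tau> <+> cm_points \<gamma>) (cm_points (\<tau> \<oplus>\<^sub>m \<gamma>))"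
    unfolding k'_def using k by (rule bij_betw_inv_into)
  have k'f: "fst (k' s) = case_sum fst fst s" if "s \<in> cm_points \<tau> <+> cm_points \<gamma>" for s
    using kf[of "k' s"] that k unfolding k'_def by (simp add: bij_betw_inv_into_right)
  have m: "bij_betw (map_sum \<phi> id) (cm_points \<sigma> <+> cm_points \<gamma>) (cm_points \<tau> <+> cm_points \<gamma>)"
    using \<phi> by (rule bij_betw_map_sum_id)
  define \<psi> where "\<psi> = k' \<circ> (map_sum \<phi> id \<circ> h)"
  have \<psi>: "bij_betw \<psi> (cm_points (\<sigma> \<oplus>\<^sub>m \<gamma>)) (cm_points (\<tau> \<oplus>\<^sub>m \<gamma>))"
    unfolding \<psi>_def using h m k' by (blast intro: bij_betw_trans)
  define c where "c s = ennreal (dist (case_sum fst fst s) (fst (k' (map_sum \<phi> id s))) powr p)" for s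
  have "matching_cost p (\<sigma> \<oplus>\<^sub>m \<gamma>) \<psi> = (\<Sum>\<^sub>\<infinity>e\<in>cm_points (\<sigma> \<oplus>\<^sub>m \<gamma>). c (h e))"
    unfolding matching_cost_def c_def \<psi>_def by (simp add: hf)
  also have "\<dots> = (\<Sum>\<^sub>\<infinity>s\<in>cm_points \<sigma> <+> cm_points \<gamma>. c s)"
    using h by (rule infsum_reindex_bij_betw)
  also have "\<dots> = (\<Sum>\<^sub>\<infinity>s\<in>Inl ` cm_points \<sigma>. c s)"
  proof (rule infsum_cong_neutral)
    fix s assume "s \<in> (cm_points \<sigma> <+> cm_points \<gamma>) - Inl ` cm_points \<sigma>"
    then obtain e where "e \<in> cm_points \<gamma>" "s = Inr e" by auto
    then show "c s = 0" by (simp add: c_def k'f InrI)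
  qed auto
  also have "\<dots> = (\<Sum>\<^sub>\<infinity>e\<in>cm_points \<sigma>. c (Inl e))"
    by (subst infsum_reindex) (auto simp: o_def)
  also have "\<dots> = matching_cost p \<sigma> \<phi>"
    unfolding matching_cost_def
  proof (rule infsum_cong)
    fix e assume "e \<in> cm_points \<sigma>"
    then have "\<phi> e \<in> cm_points \<tau>" using \<phi> by (auto simp: bij_betw_def)
    then show "c (Inl e) = ennreal (dist (fst e) (fst (\<phi> e)) powr p)"
      by (simp add: c_def k'f InlI)
  qed
  finally show "\<exists>\<psi>\<in>{\<psi>. bij_betw \<psi> (cm_points (\<sigma> \<oplus>\<^sub>m \<gamma>)) (cm_points (\<tau> \<oplus>\<^sub>m \<gamma>))}.
      epowr (matching_cost p (\<sigma> \<oplus>\<^sub>m \<gamma>) \<psi>) (1 / p) \<le> epowr (matching_cost p \<sigma> \<phi>) (1 / p)"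
    using \<psi> by auto
qed

lemma INF2_lower:
  fixes f :: "'a \<Rightarrow> 'b \<Rightarrow> ennreal"
  assumes "a \<in> S" "b \<in> T"
  shows "(INF x\<in>S. INF y\<in>T. f x y) \<le> f a b"
  using INF_lower2[OF assms(1), of "\<lambda>x. INF y\<in>T. f x y" "f a b"] INF_lower[OF assms(2), of "f a"]
  by simp

lemma cm_add_swap: "(a \<oplus>\<^sub>m b) \<oplus>\<^sub>m (c \<oplus>\<^sub>m d) = (a \<oplus>\<^sub>m c) \<oplus>\<^sub>m (b \<oplus>\<^sub>m d)"
  by (simp add: cm_add_def ac_simps)

theorem diagram_dist_class:
  assumes "\<sigma> \<in> cmsets UNIV" and "\<tau> \<in> cmsets UNIV"
  shows "diagram_dist p A (diagram_rel A `` {\<sigma>}) (diagram_rel A `` {\<tau>}) =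
    (INF \<alpha>\<in>cmsets A. INF \<beta>\<in>cmsets A. cm_dist p (\<sigma> \<oplus>\<^sub>m \<alpha>) (\<tau> \<oplus>\<^sub>m \<beta>))"  (is "?l = ?r")
proof (rule antisym)
  have "\<sigma> \<in> diagram_rel A `` {\<sigma>}" "\<tau> \<in> diagram_rel A `` {\<tau>}"
    using assms refl_diagram_rel by blast+
  then show "?l \<le> ?r"
    unfolding diagram_dist_def by (rule INF2_lower)
  show "?r \<le> ?l"
    unfolding diagram_dist_def
  proof (intro INF_greatest)
    fix \<sigma>' \<tau>' \<alpha> \<beta>
    assume s: "\<sigma>' \<in> diagram_rel A `` {\<sigma>}" and t: "\<tau>' \<in> diagram_rel A `` {\<tau>}"
      and ab: "\<alpha> \<in> cmsets A" "\<beta> \<in> cmsets A"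
    obtain \<alpha>1 \<beta>1 where m1: "\<alpha>1 \<in> cmsets A" "\<beta>1 \<in> cmsets A"
      and e1: "\<sigma> \<oplus>\<^sub>m \<alpha>1 = \<sigma>' \<oplus>\<^sub>m \<beta>1"
      using s unfolding diagram_rel_def by blast
    obtain \<alpha>2 \<beta>2 where m2: "\<alpha>2 \<in> cmsets A" "\<beta>2 \<in> cmsets A"
      and e2: "\<tau> \<oplus>\<^sub>m \<alpha>2 = \<tau>' \<oplus>\<^sub>m \<beta>2"
      using t unfolding diagram_rel_def by blast
    have "\<sigma>' \<oplus>\<^sub>m \<alpha> \<oplus>\<^sub>m (\<beta>1 \<oplus>\<^sub>m \<beta>2) = (\<sigma>' \<oplus>\<^sub>m \<beta>1) \<oplus>\<^sub>m (\<alpha> \<oplus>\<^sub>m \<beta>2)"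
      by (rule cm_add_swap)
    also have "\<dots> = \<sigma> \<oplus>\<^sub>m (\<alpha>1 \<oplus>\<^sub>m (\<alpha> \<oplus>\<^sub>m \<beta>2))"
      unfolding e1[symmetric] by (rule cm_add_assoc)
    finally have s1: "\<sigma>' \<oplus>\<^sub>m \<alpha> \<oplus>\<^sub>m (\<beta>1 \<oplus>\<^sub>m \<beta>2) = \<sigma> \<oplus>\<^sub>m (\<alpha>1 \<oplus>\<^sub>m (\<alpha> \<oplus>\<^sub>m \<beta>2))" .
    have "\<tau>' \<oplus>\<^sub>m \<beta> \<oplus>\<^sub>m (\<beta>1 \<oplus>\<^sub>m \<beta>2) = (\<tau>' \<oplus>\<^sub>m \<beta>2) \<oplus>\<^sub>m (\<beta> \<oplus>\<^sub>m \<beta>1)"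
      unfolding cm_add_commute[of \<beta>1 \<beta>2] by (rule cm_add_swap)
    also have "\<dots> = \<tau> \<oplus>\<^sub>m (\<alpha>2 \<oplus>\<^sub>m (\<beta> \<oplus>\<^sub>m \<beta>1))"
      unfolding e2[symmetric] by (rule cm_add_assoc)
    finally have s2: "\<tau>' \<oplus>\<^sub>m \<beta> \<oplus>\<^sub>m (\<beta>1 \<oplus>\<^sub>m \<beta>2) = \<tau> \<oplus>\<^sub>m (\<alpha>2 \<oplus>\<^sub>m (\<beta> \<oplus>\<^sub>m \<beta>1))" .
    have "?r \<le> cm_dist p (\<sigma> \<oplus>\<^sub>m (\<alpha>1 \<oplus>\<^sub>m (\<alpha> \<oplus>\<^sub>m \<beta>2))) (\<tau> \<oplus>\<^sub>m (\<alpha>2 \<oplus>\<^sub>m (\<beta> \<oplus>\<^sub>m \<beta>1)))"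
    proof -
      have "\<alpha>1 \<oplus>\<^sub>m (\<alpha> \<oplus>\<^sub>m \<beta>2) \<in> cmsets A" "\<alpha>2 \<oplus>\<^sub>m (\<beta> \<oplus>\<^sub>m \<beta>1) \<in> cmsets A"
        by (intro cmsets_add m1 m2 ab)+
      then show ?thesis by (rule INF2_lower)
    qed
    also have "\<dots> \<le> cm_dist p (\<sigma>' \<oplus>\<^sub>m \<alpha>) (\<tau>' \<oplus>\<^sub>m \<beta>)"
      unfolding s1[symmetric] s2[symmetric] by (rule cm_dist_add_le)
    finally show "?r \<le> cm_dist p (\<sigma>' \<oplus>\<^sub>m \<alpha>) (\<tau>' \<oplus>\<^sub>m \<beta>)" .
  qed
qed

section \<open>Dimensions of a metric space\<close>

text \<open>A metric space is given by its carrier \<open>M\<close> and its distance \<open>d\<close>. All infima below are taken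
  in complete lattices in which \<open>Inf {} = \<infinity>\<close>; for \<^typ>\<open>enat\<close> the infimum of a non-empty set
  is its least element.\<close>

definition at_most :: "nat \<Rightarrow> 'a set \<Rightarrow> bool" where
  "at_most k S \<longleftrightarrow> finite S \<and> card S \<le> k"

definition ediam :: "('a \<Rightarrow> 'a \<Rightarrow> real) \<Rightarrow> 'a set \<Rightarrow> ennreal" where
  "ediam d U = (SUP x\<in>U. SUP y\<in>U. ennreal (d x y))"

definition open_cover :: "'a topology \<Rightarrow> 'a set set \<Rightarrow> bool" where
  "open_cover X \<U> \<longleftrightarrow> (\<forall>U\<in>\<U>. openin X U) \<and> \<Union>\<U> = topspace X"

definition covering_dim :: "'a topology \<Rightarrow> enat" where
  "covering_dim X = Inf {enat m | m. \<forall>\<U>. finite \<U> \<and> open_cover X \<U> \<longrightarrow>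
     (\<exists>\<V>. open_cover X \<V> \<and> (\<forall>V\<in>\<V>. \<exists>U\<in>\<U>. V \<subseteq> U) \<and>
       (\<forall>x\<in>topspace X. at_most (m + 1) {V\<in>\<V>. x \<in> V}))}"

text \<open>The conventions \<open>diam {} ^ s = 0\<close> and \<open>0 ^ 0 = 1\<close> make the measure for \<open>s = 0\<close> the counting
  measure.\<close>

definition hausdorff_gauge :: "('a \<Rightarrow> 'a \<Rightarrow> real) \<Rightarrow> real \<Rightarrow> 'a set \<Rightarrow> ennreal" where
  "hausdorff_gauge d s U = (if U = {} then 0 else if s = 0 then 1 else epowr (ediam d U) s)"

definition hausdorff_content ::
    "'a set \<Rightarrow> ('a \<Rightarrow> 'a \<Rightarrow> real) \<Rightarrow> real \<Rightarrow> real \<Rightarrow> ennreal" where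
  "hausdorff_content M d s \<delta> =
     (INF U\<in>{U :: nat \<Rightarrow> 'a set. (\<Union>i. U i) = M \<and> (\<forall>i. ediam d (U i) \<le> ennreal \<delta>)}.
        (\<Sum>i. hausdorff_gauge d s (U i)))"

definition hausdorff_measure :: "'a set \<Rightarrow> ('a \<Rightarrow> 'a \<Rightarrow> real) \<Rightarrow> real \<Rightarrow> ennreal" where
  "hausdorff_measure M d s = (SUP \<delta>\<in>{0<..}. hausdorff_content M d s \<delta>)"

definition hausdorff_dim :: "'a set \<Rightarrow> ('a \<Rightarrow> 'a \<Rightarrow> real) \<Rightarrow> ennreal" where
  "hausdorff_dim M d = Inf {ennreal s | s. 0 \<le> s \<and> hausdorff_measure M d s = 0}"

definition asymptotic_dim :: "'a set \<Rightarrow> ('a \<Rightarrow> 'a \<Rightarrow> real) \<Rightarrow> enat" where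
  "asymptotic_dim M d = Inf {enat m | m. \<forall>R>0. \<exists>\<U>. \<Union>\<U> = M \<and>
     (\<exists>D::real. \<forall>U\<in>\<U>. ediam d U \<le> ennreal D) \<and>
     (\<forall>x\<in>M. at_most (m + 1) {U\<in>\<U>. U \<inter> Metric_space.mball M d x R \<noteq> {}})}"

definition assouad_dim :: "'a set \<Rightarrow> ('a \<Rightarrow> 'a \<Rightarrow> real) \<Rightarrow> ennreal" where
  "assouad_dim M d = Inf {ennreal s | s. 0 \<le> s \<and>
     (\<exists>C>0. \<forall>r R. 0 < r \<and> r < R \<longrightarrow> (\<forall>x\<in>M. \<exists>F\<subseteq>M. finite F \<and>
        real (card F) \<le> C * (R / r) powr s \<and>
        Metric_space.mball M d x R \<subseteq> (\<Union>y\<in>F. Metric_space.mball M d y r)))}"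

definition assouad_nagata_dim :: "'a set \<Rightarrow> ('a \<Rightarrow> 'a \<Rightarrow> real) \<Rightarrow> enat" where
  "assouad_nagata_dim M d = Inf {enat m | m. \<exists>c>0. \<forall>r>0. \<exists>\<U>. \<Union>\<U> = M \<and>
     (\<forall>U\<in>\<U>. ediam d U \<le> ennreal (c * r)) \<and>
     (\<forall>S\<subseteq>M. ediam d S \<le> ennreal r \<longrightarrow> at_most (m + 1) {U\<in>\<U>. U \<inter> S \<noteq> {}})}"

end

theory Submission
  imports Defs
begin

text \<open>Finitely many points off the diagonal can be moved independently of each other. If \<open>k\<close> points
  are far apart from one another and from the diagonal, compared with the distance \<open>L\<close> by which they
  are allowed to move along a line, then the cheapest matching of two such configurations is the
  obvious one, and \<open>[0, L]\<^sup>k\<close> embeds into the space of diagrams with a distortion that depends on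
  \<open>k\<close> only. As \<open>\<real>\<^sup>2\<^sup>n\<close> has points arbitrarily far from the diagonal, this works for all \<open>k\<close> and
  all \<open>L\<close>, so that the space contains cubes of every dimension and of every size. Unit cubes make the
  covering, Hausdorff and Assouad dimensions infinite, large ones the asymptotic and Assouad--Nagata
  dimensions.

  The precise form of the embedding is \<open>lipschitz_cube\<close>: the coordinates of the cube extend to
  \<open>1\<close>-Lipschitz functions on all diagrams. Such functions are suprema over the points of a diagram of
  a tent function that vanishes on the diagonal (\<open>height_lipschitz\<close>, \<open>ex_lipschitz_cube\<close>), since a
  matching of cost \<open>c\<close> moves no point by more than \<open>c\<close>. They yield the lower bound for distances
  without any discussion of optimal matchings.

  Three of the dimensions are covering dimensions of some kind, and for them the reason is the
  Lebesgue covering theorem (\<open>cube_cover_order\<close>): if no member of a cover of a \<open>k\<close>-cube meets two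
  opposite faces, then some point is close to \<open>k + 1\<close> members. It is derived from Kuhn's combinatorial
  lemma. The Assouad dimension follows by counting grid points and the Hausdorff dimension from
  Lebesgue measure.

  Balls and open sets refer to the metric \<open>d\<^sub>p\<close>, so it is also shown that \<open>d\<^sub>p\<close> is one
  (\<open>Metric_space_pdiagrams\<close>). The triangle inequality is Minkowski's inequality; definiteness holds
  because a diagram at finite distance from the empty one has only finitely many points away from
  \<open>A\<close>, so that a matching of small cost cannot move a point of high persistence at all.\<close>

section \<open>The Lebesgue covering theorem\<close>

text \<open>Kuhn's lemma provides a fully labelled simplex for a labelling of the grid \<open>{0..N}\<^sup>k\<close> that
  is \<open>0\<close> on the lower faces and \<open>1\<close> on the upper ones. Applied to the labels \<open>lab\<close> below, which see
  a grid point only through its value under \<open>W\<close>, it yields a covering theorem: points with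
  different reduced labels have different values, and a full simplex has \<open>k + 1\<close> reduced labels.\<close>

lemma kuhn_distinct_labels:
  fixes W :: "(nat \<Rightarrow> nat) \<Rightarrow> 'b"
  assumes N: "0 < N"
    and faces: "\<And>x y i. (\<forall>j. x j \<le> N) \<Longrightarrow> (\<forall>j. y j \<le> N) \<Longrightarrow> i < k \<Longrightarrow> x i = 0 \<Longrightarrow> y i = N
      \<Longrightarrow> W x \<noteq> W y"
  obtains q S where "finite S" "q \<in> S" "Suc k \<le> card (W ` S)"
    "\<And>x j. x \<in> S \<Longrightarrow> x j \<le> N \<and> q j \<le> x j \<and> x j \<le> Suc (q j)"
proof -
  define lab where
    "lab w i = (if \<exists>y. (\<forall>j. y j \<le> N) \<and> W y = w \<and> y i = 0 then 0 else 1 :: nat)" for w i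
  have "odd (card {s. ksimplex N k s \<and> (reduced k \<circ> (lab \<circ> W)) ` s = {..k}})"
    using N faces by (intro kuhn_combinatorial) (auto simp: lab_def)
  then have "{s. ksimplex N k s \<and> (reduced k \<circ> (lab \<circ> W)) ` s = {..k}} \<noteq> {}"
    by (rule odd_card_imp_not_empty)
  then obtain S where S: "ksimplex N k S" and full: "(reduced k \<circ> (lab \<circ> W)) ` S = {..k}"
    by auto
  from S obtain q u where "kuhn_simplex N k q u S"
    by (auto elim: ksimplex.cases)
  then interpret kuhn_simplex N k q u S .
  have fin: "finite S" by (simp add: s_eq)
  have "Suc k = card ((reduced k \<circ> lab) ` W ` S)"
    using full by (simp add: image_comp o_assoc)
  also have "\<dots> \<le> card (W ` S)"
    using fin by (intro card_image_le) auto
  finally have card: "Suc k \<le> card (W ` S)" .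
  have "x j \<le> N \<and> q j \<le> x j \<and> x j \<le> Suc (q j)" if "x \<in> S" for x j
  proof (cases "j < k")
    case True
    then show ?thesis
      using base_le[OF that] le_Suc_base[OF that] s_space that by auto
  next
    case False
    then have "j \<notin> u ` {..<i}" if "i \<le> k" for i
      using upd that by (auto simp: bij_betw_def)
    with \<open>x \<in> S\<close> have "x j = q j"
      by (auto simp: s_eq enum_def)
    then show ?thesis using base_out[of j] False by auto
  qed
  with fin base_in_s card show thesis by (rule that)
qed

text \<open>The carrier is the type of all sequences, so that \<open>k\<close> can be an arbitrary number inside a
  statement; the coordinates from \<open>k\<close> on are unconstrained.\<close>

definition cube :: "nat \<Rightarrow> real \<Rightarrow> (nat \<Rightarrow> real) set" where
  "cube k L = {t. \<forall>i<k. 0 \<le> t i \<and> t i \<le> L}"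

lemma at_most_subset: "at_most k T \<Longrightarrow> S \<subseteq> T \<Longrightarrow> at_most k S"
  unfolding at_most_def by (meson card_mono finite_subset le_trans)

text \<open>The Lebesgue covering theorem in metric form. Attach to each point of a grid of mesh at most
  \<open>\<rho>\<close> a member of the cover containing it. Since no member meets opposite faces, the combinatorial
  lemma applies, and its base point is within \<open>\<rho>\<close> of \<open>k + 1\<close> different members.\<close>

theorem cube_cover_order:
  assumes L: "0 < L" and \<rho>: "0 < \<rho>"
    and cover: "\<And>t. t \<in> cube k L \<Longrightarrow> \<exists>j\<in>J. t \<in> W j"
    and faces: "\<And>j s t i. \<lbrakk>j \<in> J; i < k; s \<in> W j \<inter> cube k L; t \<in> W j \<inter> cube k L; s i = 0\<rbrakk>
      \<Longrightarrow> t i \<noteq> L"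
  shows "\<exists>t\<in>cube k L. \<not> at_most k {j\<in>J. \<exists>s\<in>W j \<inter> cube k L. \<forall>i<k. \<bar>s i - t i\<bar> \<le> \<rho>}"
proof -
  obtain N :: nat where "L / \<rho> < N" using reals_Archimedean2 by blast
  moreover have "0 < L / \<rho>" using L \<rho> by simp
  ultimately have "0 < N" and LN: "L < \<rho> * N"
    using \<rho> by (auto simp: field_simps intro: gr0I)
  then have N: "0 < N" "L / N \<le> \<rho>"
    by (simp_all add: pos_divide_le_eq)
  define pt where "pt x = (\<lambda>i. L / N * real (x i))" for x :: "nat \<Rightarrow> nat"
  have pt: "pt x \<in> cube k L" if "\<forall>j. x j \<le> N" for x
    using that L N by (auto simp: cube_def pt_def field_simps)
  have "\<exists>w. \<forall>x. (\<forall>j. x j \<le> N) \<longrightarrow> w x \<in> J \<and> pt x \<in> W (w x)"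
    using cover[OF pt] by (intro choice) blast
  then obtain w where w: "\<And>x. (\<forall>j. x j \<le> N) \<Longrightarrow> w x \<in> J \<and> pt x \<in> W (w x)"
    by blast
  have sep: "w x \<noteq> w y" if xy: "\<forall>j. x j \<le> N" "\<forall>j. y j \<le> N" "i < k" "x i = 0" "y i = N" for x y i
  proof
    assume eq: "w x = w y"
    have "pt y i \<noteq> L"
      using w[OF xy(1)] w[OF xy(2)] pt[OF xy(1)] pt[OF xy(2)] xy eq
      by (intro faces[of "w y" i "pt x"]) (auto simp: pt_def)
    then show False using xy N by (simp add: pt_def)
  qed
  obtain q S where S: "finite S" "q \<in> S" "Suc k \<le> card (w ` S)"
    and near: "\<And>x j. x \<in> S \<Longrightarrow> x j \<le> N \<and> q j \<le> x j \<and> x j \<le> Suc (q j)"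
    by (rule kuhn_distinct_labels[of N k w]) (use N(1) sep in blast)+
  let ?H = "{j\<in>J. \<exists>s\<in>W j \<inter> cube k L. \<forall>i<k. \<bar>s i - pt q i\<bar> \<le> \<rho>}"
  have "w ` S \<subseteq> ?H"
  proof clarify
    fix x assume x: "x \<in> S"
    have "\<bar>pt x i - pt q i\<bar> \<le> \<rho>" for i
    proof -
      have "\<bar>pt x i - pt q i\<bar> = L / N * \<bar>real (x i) - real (q i)\<bar>"
        using L N by (simp only: pt_def abs_mult abs_of_nonneg flip: right_diff_distrib) simp
      also have "\<dots> \<le> L / N * 1"
        using near[OF x, of i] L N by (intro mult_left_mono) auto
      finally show ?thesis using N by simp
    qed
    then show "w x \<in> J \<and> (\<exists>s\<in>W (w x) \<inter> cube k L. \<forall>i<k. \<bar>s i - pt q i\<bar> \<le> \<rho>)"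
      using w[of x] pt[of x] near[OF x] by blast
  qed
  then have "\<not> at_most k ?H"
    using S(3) card_mono[of ?H "w ` S"] unfolding at_most_def by linarith
  then show ?thesis using pt[of q] near[OF \<open>q \<in> S\<close>] by blast
qed

text \<open>For the covering dimension the metric form above is applied after shrinking an open cover; the
  amount of shrinking is a Lebesgue number.\<close>

lemma cube_lebesgue_number:
  assumes L: "0 \<le> L"
    and loc: "\<And>t. t \<in> cube k L \<Longrightarrow>
      \<exists>j\<in>J. \<exists>\<epsilon>>0. \<forall>s\<in>cube k L. (\<forall>i<k. \<bar>s i - t i\<bar> < \<epsilon>) \<longrightarrow> s \<in> W j"
  obtains \<rho> where "0 < \<rho>"
    "\<And>t. t \<in> cube k L \<Longrightarrow> \<exists>j\<in>J. \<forall>s\<in>cube k L. (\<forall>i<k. \<bar>s i - t i\<bar> < \<rho>) \<longrightarrow> s \<in> W j"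
proof -
  \<comment> \<open>The cube itself is not compact, its later coordinates being free. The Hilbert cube \<open>H\<close> is,
    and it represents every point of the cube up to those coordinates.\<close>
  define H where "H = (PiE UNIV (\<lambda>_. {0..L}) :: (nat \<Rightarrow> real) set)"
  have "compact H"
    unfolding H_def using compactin_PiE[of "\<lambda>_. euclidean" UNIV "\<lambda>_::nat. {0..L}"]
    by (simp add: euclidean_product_topology)
  have H: "H \<subseteq> cube k L" by (auto simp: H_def cube_def PiE_iff)
  have "\<exists>e. \<forall>t\<in>H. 0 < e t \<and> (\<exists>j\<in>J. \<forall>s\<in>cube k L. (\<forall>i<k. \<bar>s i - t i\<bar> < e t) \<longrightarrow> s \<in> W j)"
    using loc H by (intro bchoice) blast
  then obtain e where e: "\<And>t. t \<in> H \<Longrightarrow> 0 < e t"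
      "\<And>t. t \<in> H \<Longrightarrow> \<exists>j\<in>J. \<forall>s\<in>cube k L. (\<forall>i<k. \<bar>s i - t i\<bar> < e t) \<longrightarrow> s \<in> W j"
    by blast
  define U where "U t = (\<Inter>i<k. {s. \<bar>s i - t i\<bar> < e t / 2})" for t :: "nat \<Rightarrow> real"
  have "open (U t)" for t
    unfolding U_def
    by (intro open_INT finite_lessThan ballI open_Collect_less continuous_intros
        continuous_on_product_coordinates)
  moreover have "H \<subseteq> (\<Union>t\<in>H. U t)"
    using e(1) by (force simp: U_def)
  ultimately obtain T where T: "T \<subseteq> H" "finite T" "H \<subseteq> (\<Union>t\<in>T. U t)"
    using compactE_image[OF \<open>compact H\<close>, of H U] by auto
  define \<rho> where "\<rho> = Min (insert 1 (e ` T)) / 2"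
  have "0 < \<rho>" using T e(1) by (auto simp: \<rho>_def)
  moreover have "\<exists>j\<in>J. \<forall>s\<in>cube k L. (\<forall>i<k. \<bar>s i - t i\<bar> < \<rho>) \<longrightarrow> s \<in> W j" if t: "t \<in> cube k L" for t
  proof -
    have "(\<lambda>i. if i < k then t i else 0) \<in> H"
      using t L by (auto simp: H_def cube_def)
    then obtain c where c: "c \<in> T" "(\<lambda>i. if i < k then t i else 0) \<in> U c"
      using T by blast
    then have tc: "\<bar>t i - c i\<bar> < e c / 2" if "i < k" for i
      using that by (auto simp: U_def)
    have \<rho>c: "\<rho> \<le> e c / 2" using T c by (auto simp: \<rho>_def)
    obtain j where j: "j \<in> J" "\<forall>s\<in>cube k L. (\<forall>i<k. \<bar>s i - c i\<bar> < e c) \<longrightarrow> s \<in> W j"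
      using e(2) c T by blast
    have "s \<in> W j" if s: "s \<in> cube k L" "\<forall>i<k. \<bar>s i - t i\<bar> < \<rho>" for s
    proof -
      have "\<bar>s i - c i\<bar> < e c" if "i < k" for i
        using tc[OF that] s(2)[rule_format, OF that] \<rho>c by linarith
      with j s show ?thesis by blast
    qed
    with j show ?thesis by blast
  qed
  ultimately show thesis by (rule that)
qed

section \<open>Dimensions of spaces that contain cubes\<close>

text \<open>A copy \<open>f\<close> of a cube in \<open>M\<close> whose coordinates extend to functions \<open>g i\<close> on all of \<open>M\<close> that are
  \<open>1\<close>-Lipschitz. The extension replaces closedness of the image and the choice of nearest points:
  sets and balls in \<open>M\<close> that are not centred on the cube are still controlled by the \<open>g i\<close>. The
  distortion \<open>k\<close> is harmless because it depends on the dimension only, not on the side \<open>L\<close>.\<close>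

locale lipschitz_cube =
  fixes M :: "'a set" and d :: "'a \<Rightarrow> 'a \<Rightarrow> real" and k :: nat and L :: real
    and f :: "(nat \<Rightarrow> real) \<Rightarrow> 'a" and g :: "nat \<Rightarrow> 'a \<Rightarrow> real"
  assumes k_pos: "0 < k" and L_pos: "0 < L"
    and f_in: "t \<in> cube k L \<Longrightarrow> f t \<in> M"
    and f_upper: "\<And>\<eta> :: real. \<lbrakk>s \<in> cube k L; t \<in> cube k L; \<And>i. i < k \<Longrightarrow> \<bar>s i - t i\<bar> \<le> \<eta>\<rbrakk>
      \<Longrightarrow> d (f s) (f t) \<le> real k * \<eta>"
    and g_lipschitz: "\<lbrakk>x \<in> M; y \<in> M; i < k\<rbrakk> \<Longrightarrow> \<bar>g i x - g i y\<bar> \<le> d x y"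
    and g_f: "\<lbrakk>t \<in> cube k L; i < k\<rbrakk> \<Longrightarrow> g i (f t) = t i"
begin

lemma coordinate_le_dist:
  "\<lbrakk>s \<in> cube k L; t \<in> cube k L; i < k\<rbrakk> \<Longrightarrow> \<bar>s i - t i\<bar> \<le> d (f s) (f t)"
  using g_lipschitz[OF f_in f_in, of s t i] by (simp add: g_f)

lemma coordinate_le_diam:
  assumes "ediam d U \<le> ennreal D" "0 \<le> D" "s \<in> cube k L" "t \<in> cube k L" "f s \<in> U" "f t \<in> U" "i < k"
  shows "\<bar>s i - t i\<bar> \<le> D"
proof -
  have "ennreal (d (f s) (f t)) \<le> ediam d U"
    unfolding ediam_def using assms by (intro SUP_upper2[of "f s"] SUP_upper2[of "f t"]) auto
  also note assms(1)
  finally have "d (f s) (f t) \<le> D"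
    using assms(2) by simp
  with coordinate_le_dist[of s t i] assms show ?thesis by linarith
qed

text \<open>The covering theorem transported to \<open>M\<close>: sets of diameter less than the side of the cube do not
  meet opposite faces.\<close>

lemma family_order:
  assumes cover: "\<Union>\<U> = M" and D: "\<And>U. U \<in> \<U> \<Longrightarrow> ediam d U \<le> ennreal D" "0 \<le> D" "D < L"
    and \<rho>: "0 < \<rho>"
  shows "\<exists>t\<in>cube k L. \<not> at_most k {U\<in>\<U>. \<exists>s\<in>cube k L. f s \<in> U \<and> (\<forall>i<k. \<bar>s i - t i\<bar> \<le> \<rho>)}"
proof -
  have "\<exists>t\<in>cube k L. \<not> at_most k
      {U\<in>\<U>. \<exists>s\<in>{s. f s \<in> U} \<inter> cube k L. \<forall>i<k. \<bar>s i - t i\<bar> \<le> \<rho>}"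
  proof (rule cube_cover_order[OF L_pos \<rho>])
    show "\<exists>U\<in>\<U>. t \<in> {s. f s \<in> U}" if "t \<in> cube k L" for t
      using f_in[OF that] cover by auto
    show "t i \<noteq> L" if "U \<in> \<U>" "i < k" "s \<in> {s. f s \<in> U} \<inter> cube k L" "t \<in> {s. f s \<in> U} \<inter> cube k L"
        "s i = 0" for U s t i
      using coordinate_le_diam[OF D(1)[OF that(1)] D(2), of s t i] that D(3) L_pos by auto
  qed
  then show ?thesis by (simp add: conj_assoc Bex_def Int_def conj_left_commute)
qed

end

lemma Inf_enat_eq_infinity: "(\<And>m. \<not> P m) \<Longrightarrow> Inf {enat m | m. P m} = \<infinity>"
  by (simp add: Inf_enat_def)

lemma Inf_ennreal_eq_infinity: "(\<And>s. \<not> P s) \<Longrightarrow> Inf {ennreal s | s. P s} = \<infinity>"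
  by simp

text \<open>A cover of order \<open>m + 1\<close> at scale \<open>1\<close> by sets of diameter at most \<open>D\<close> contradicts the covering
  theorem on a cube of dimension \<open>m + 1\<close> with side larger than \<open>D\<close>.\<close>

lemma asymptotic_dim_infinite:
  assumes M: "Metric_space M d" and cubes: "\<And>k L. 0 < k \<Longrightarrow> 0 < L \<Longrightarrow> \<exists>f g. lipschitz_cube M d k L f g"
  shows "asymptotic_dim M d = \<infinity>"
  unfolding asymptotic_dim_def
proof (intro Inf_enat_eq_infinity notI)
  fix m
  interpret Metric_space M d by fact
  assume bound: "\<forall>R>0. \<exists>\<U>. \<Union>\<U> = M \<and> (\<exists>D::real. \<forall>U\<in>\<U>. ediam d U \<le> ennreal D) \<and>
     (\<forall>x\<in>M. at_most (m + 1) {U\<in>\<U>. U \<inter> mball x R \<noteq> {}})"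
  from bound[THEN spec, THEN mp, OF zero_less_one] obtain \<U> and D :: real where cover: "\<Union>\<U> = M"
      and diam: "\<forall>U\<in>\<U>. ediam d U \<le> ennreal D"
      and mult: "\<forall>x\<in>M. at_most (m + 1) {U\<in>\<U>. U \<inter> mball x 1 \<noteq> {}}"
    by (elim exE conjE)
  have ord: "at_most (m + 1) {U\<in>\<U>. U \<inter> mball x 1 \<noteq> {}}" if "x \<in> M" for x
    using mult that by blast
  have "0 < max D 0 + 1" by linarith
  then obtain f g where "lipschitz_cube M d (m + 1) (max D 0 + 1) f g"
    using cubes[of "m + 1" "max D 0 + 1"] by auto
  then interpret lipschitz_cube M d "m + 1" "max D 0 + 1" f g .
  let ?\<rho> = "1 / (2 * real (m + 1))"
  obtain t where t: "t \<in> cube (m + 1) (max D 0 + 1)" and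
    many: "\<not> at_most (m + 1) {U\<in>\<U>. \<exists>s\<in>cube (m + 1) (max D 0 + 1). f s \<in> U \<and>
      (\<forall>i<m + 1. \<bar>s i - t i\<bar> \<le> ?\<rho>)}"
  proof -
    have "ennreal D \<le> ennreal (max D 0)" by (intro ennreal_leI) simp
    then have "ediam d U \<le> ennreal (max D 0)" if "U \<in> \<U>" for U
      using diam that order_trans by blast
    then show thesis
      using family_order[OF cover, of "max D 0" ?\<rho>] that by auto
  qed
  have "f s \<in> mball (f t) 1"
    if s: "s \<in> cube (m + 1) (max D 0 + 1)" "\<forall>i<m + 1. \<bar>s i - t i\<bar> \<le> ?\<rho>" for s
  proof -
    have "d (f s) (f t) \<le> real (m + 1) * ?\<rho>"
      using s t by (intro f_upper) auto
    also have "\<dots> < 1" by simp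
    finally show ?thesis using f_in s t by (simp add: commute)
  qed
  then have "at_most (m + 1) {U\<in>\<U>. \<exists>s\<in>cube (m + 1) (max D 0 + 1). f s \<in> U \<and>
      (\<forall>i<m + 1. \<bar>s i - t i\<bar> \<le> ?\<rho>)}"
    by (intro at_most_subset[OF ord[OF f_in[OF t]]]) blast
  with many show False ..
qed

text \<open>The scale \<open>r = 1\<close> alone gives a contradiction, as for the asymptotic dimension, with the
  images of small cubes as test sets.\<close>

lemma assouad_nagata_dim_infinite:
  assumes cubes: "\<And>k L. 0 < k \<Longrightarrow> 0 < L \<Longrightarrow> \<exists>f g. lipschitz_cube M d k L f g"
  shows "assouad_nagata_dim M d = \<infinity>"
  unfolding assouad_nagata_dim_def
proof (intro Inf_enat_eq_infinity notI)
  fix m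
  assume "\<exists>c>0. \<forall>r>0. \<exists>\<U>. \<Union>\<U> = M \<and> (\<forall>U\<in>\<U>. ediam d U \<le> ennreal (c * r)) \<and>
     (\<forall>S\<subseteq>M. ediam d S \<le> ennreal r \<longrightarrow> at_most (m + 1) {U\<in>\<U>. U \<inter> S \<noteq> {}})"
  then obtain c where c: "0 < c" and bound: "\<forall>r>0. \<exists>\<U>. \<Union>\<U> = M \<and>
     (\<forall>U\<in>\<U>. ediam d U \<le> ennreal (c * r)) \<and>
     (\<forall>S\<subseteq>M. ediam d S \<le> ennreal r \<longrightarrow> at_most (m + 1) {U\<in>\<U>. U \<inter> S \<noteq> {}})"
    by (elim exE conjE)
  from bound[THEN spec, THEN mp, OF zero_less_one] obtain \<U> where cover: "\<Union>\<U> = M"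
      and D: "\<And>U. U \<in> \<U> \<Longrightarrow> ediam d U \<le> ennreal c"
      and ord: "\<And>S. S \<subseteq> M \<Longrightarrow> ediam d S \<le> ennreal 1 \<Longrightarrow> at_most (m + 1) {U\<in>\<U>. U \<inter> S \<noteq> {}}"
    by auto
  obtain f g where "lipschitz_cube M d (m + 1) (c + 1) f g"
    using cubes[of "m + 1" "c + 1"] c by auto
  then interpret lipschitz_cube M d "m + 1" "c + 1" f g .
  let ?\<rho> = "1 / (2 * real (m + 1))"
  obtain t where t: "t \<in> cube (m + 1) (c + 1)" and
    many: "\<not> at_most (m + 1) {U\<in>\<U>. \<exists>s\<in>cube (m + 1) (c + 1). f s \<in> U \<and> (\<forall>i<m + 1. \<bar>s i - t i\<bar> \<le> ?\<rho>)}"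
    using family_order[OF cover D, of ?\<rho>] c by auto
  define S where "S = f ` {s \<in> cube (m + 1) (c + 1). \<forall>i<m + 1. \<bar>s i - t i\<bar> \<le> ?\<rho>}"
  have "d (f s) (f s') \<le> 1"
    if "s \<in> cube (m + 1) (c + 1)" "\<forall>i<m + 1. \<bar>s i - t i\<bar> \<le> ?\<rho>"
       "s' \<in> cube (m + 1) (c + 1)" "\<forall>i<m + 1. \<bar>s' i - t i\<bar> \<le> ?\<rho>" for s s'
  proof -
    have "\<bar>s i - s' i\<bar> \<le> 2 * ?\<rho>" if "i < m + 1" for i
      using \<open>\<forall>i<m + 1. \<bar>s i - t i\<bar> \<le> ?\<rho>\<close>[rule_format, OF that]
        \<open>\<forall>i<m + 1. \<bar>s' i - t i\<bar> \<le> ?\<rho>\<close>[rule_format, OF that] by linarith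
    then have "d (f s) (f s') \<le> real (m + 1) * (2 * ?\<rho>)"
      using that by (intro f_upper) auto
    also have "\<dots> = 1" by simp
    finally show ?thesis .
  qed
  then have "ediam d S \<le> ennreal 1"
    unfolding ediam_def S_def by (intro SUP_least ennreal_leI) blast
  moreover have "S \<subseteq> M" using f_in by (auto simp: S_def)
  ultimately have "at_most (m + 1) {U\<in>\<U>. U \<inter> S \<noteq> {}}" by (intro ord)
  then have "at_most (m + 1) {U\<in>\<U>. \<exists>s\<in>cube (m + 1) (c + 1). f s \<in> U \<and> (\<forall>i<m + 1. \<bar>s i - t i\<bar> \<le> ?\<rho>)}"
    by (rule at_most_subset) (auto simp: S_def)
  with many show False ..
qed

text \<open>The half-lines below \<open>1\<close> and above \<open>0\<close> cover the line; their products, pulled back by the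
  coordinates \<open>g i\<close>, form a finite open cover of \<open>M\<close>. A member of any refinement misses one of
  the two faces in each direction, so the covering theorem bounds the order from below.\<close>

lemma covering_dim_infinite:
  assumes M: "Metric_space M d" and cubes: "\<And>k L. 0 < k \<Longrightarrow> 0 < L \<Longrightarrow> \<exists>f g. lipschitz_cube M d k L f g"
  shows "covering_dim (Metric_space.mtopology M d) = \<infinity>"
  unfolding covering_dim_def
proof (intro Inf_enat_eq_infinity notI)
  fix m
  interpret Metric_space M d by fact
  assume refine: "\<forall>\<U>. finite \<U> \<and> open_cover mtopology \<U> \<longrightarrow>
     (\<exists>\<V>. open_cover mtopology \<V> \<and> (\<forall>V\<in>\<V>. \<exists>U\<in>\<U>. V \<subseteq> U) \<and>
       (\<forall>x\<in>topspace mtopology. at_most (m + 1) {V\<in>\<V>. x \<in> V}))"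
  let ?k = "m + 1"
  obtain f g where "lipschitz_cube M d ?k 1 f g"
    using cubes[of ?k 1] by auto
  then interpret lipschitz_cube M d ?k 1 f g .
  define U where "U A = {x\<in>M. (\<forall>i\<in>A. g i x < 1) \<and> (\<forall>i\<in>{..<?k} - A. 0 < g i x)}" for A
  define \<U> where "\<U> = U ` Pow {..<?k}"
  have U_open: "openin mtopology (U A)" if A: "A \<subseteq> {..<?k}" for A
    unfolding openin_mtopology
  proof safe
    show "x \<in> M" if "x \<in> U A" for x using that by (simp add: U_def)
    fix x assume x: "x \<in> U A"
    define r where "r = Min (insert 1 ((\<lambda>i. 1 - g i x) ` A \<union> (\<lambda>i. g i x) ` ({..<?k} - A)))"
    have fin: "finite (insert 1 ((\<lambda>i. 1 - g i x) ` A \<union> (\<lambda>i. g i x) ` ({..<?k} - A)))"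
      using A by (auto intro: finite_subset)
    have "0 < r" unfolding r_def using fin x by (subst Min_gr_iff) (auto simp: U_def)
    moreover have "mball x r \<subseteq> U A"
    proof
      fix y assume y: "y \<in> mball x r"
      have 1: "g i y < 1" if "i \<in> A" for i
      proof -
        have "r \<le> 1 - g i x" unfolding r_def using fin that by (intro Min_le) auto
        then show ?thesis using g_lipschitz[of x y i] y that A by auto
      qed
      have 2: "0 < g i y" if "i \<in> {..<?k} - A" for i
      proof -
        have "r \<le> g i x" unfolding r_def using fin that by (intro Min_le) auto
        then show ?thesis using g_lipschitz[of x y i] y that by auto
      qed
      from 1 2 y show "y \<in> U A" by (simp add: U_def)
    qed
    ultimately show "\<exists>r>0. mball x r \<subseteq> U A" by blast
  qed
  have "x \<in> U {i\<in>{..<?k}. g i x < 1}" if "x \<in> M" for x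
    using that by (auto simp: U_def)
  moreover have "{i\<in>{..<?k}. g i x < 1} \<in> Pow {..<?k}" for x by auto
  ultimately have "M \<subseteq> \<Union>\<U>" unfolding \<U>_def by blast
  moreover have "\<Union>\<U> \<subseteq> M" by (auto simp: \<U>_def U_def)
  ultimately have "\<Union>\<U> = M" by (rule antisym[rotated])
  then have "finite \<U> \<and> open_cover mtopology \<U>"
    using U_open by (auto simp: \<U>_def open_cover_def)
  then obtain \<V> where \<V>: "open_cover mtopology \<V>" "\<And>V. V \<in> \<V> \<Longrightarrow> \<exists>U\<in>\<U>. V \<subseteq> U"
      "\<And>x. x \<in> M \<Longrightarrow> at_most ?k {V\<in>\<V>. x \<in> V}"
    using refine by (metis topspace_mtopology)
  have loc: "\<exists>V\<in>\<V>. \<exists>\<epsilon>>0. \<forall>s\<in>cube ?k 1. (\<forall>i<?k. \<bar>s i - t i\<bar> < \<epsilon>) \<longrightarrow> s \<in> {s. f s \<in> V}"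
    if t: "t \<in> cube ?k 1" for t
  proof -
    obtain V where V: "V \<in> \<V>" "f t \<in> V"
      using \<V>(1) f_in[OF t] by (auto simp: open_cover_def)
    have "openin mtopology V" using V(1) \<V>(1) by (simp add: open_cover_def)
    then obtain r where r: "0 < r" "mball (f t) r \<subseteq> V"
      using V(2) unfolding openin_mtopology by blast
    have "f s \<in> V" if s: "s \<in> cube ?k 1" "\<forall>i<?k. \<bar>s i - t i\<bar> < r / (2 * real ?k)" for s
    proof -
      have "d (f s) (f t) \<le> real ?k * (r / (2 * real ?k))"
        using s t by (intro f_upper) (auto intro: less_imp_le)
      also have "\<dots> = r / 2" by (simp add: field_simps)
      also have "\<dots> < r" using r by simp
      finally show ?thesis using f_in s t r by (auto simp: commute)
    qed
    moreover have "0 < r / (2 * real ?k)" using r by simp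
    ultimately show ?thesis using V by blast
  qed
  obtain \<rho> where \<rho>: "0 < \<rho>" "\<And>t. t \<in> cube ?k 1 \<Longrightarrow>
      \<exists>V\<in>\<V>. \<forall>s\<in>cube ?k 1. (\<forall>i<?k. \<bar>s i - t i\<bar> < \<rho>) \<longrightarrow> s \<in> {s. f s \<in> V}"
    using cube_lebesgue_number[where J = \<V> and W = "\<lambda>V. {s. f s \<in> V}", OF _ loc] by auto
  \<comment> \<open>The sets \<open>V\<close>, shrunk by \<open>\<rho>\<close>, still cover the cube; a point within \<open>\<rho> / 2\<close> of a shrunk set
    lies in the original one.\<close>
  define W where "W V = {t. \<forall>s\<in>cube ?k 1. (\<forall>i<?k. \<bar>s i - t i\<bar> < \<rho>) \<longrightarrow> f s \<in> V}" for V
  have "\<exists>t\<in>cube ?k 1. \<not> at_most ?k {V\<in>\<V>. \<exists>s\<in>W V \<inter> cube ?k 1. \<forall>i<?k. \<bar>s i - t i\<bar> \<le> \<rho> / 2}"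
  proof (rule cube_cover_order)
    show "\<exists>V\<in>\<V>. t \<in> W V" if "t \<in> cube ?k 1" for t
      using \<rho>(2)[OF that] by (auto simp: W_def)
    fix V s t i assume V: "V \<in> \<V>" "i < ?k" "s \<in> W V \<inter> cube ?k 1" "t \<in> W V \<inter> cube ?k 1" "s i = 0"
    have in_V: "f s \<in> V" "f t \<in> V" using V \<rho>(1) by (auto simp: W_def)
    obtain A where A: "A \<subseteq> {..<?k}" "V \<subseteq> U A" using \<V>(2)[OF V(1)] by (auto simp: \<U>_def)
    then have mem: "f s \<in> U A" "f t \<in> U A" using in_V by auto
    have val: "g i (f s) = 0" "g i (f t) = t i"
      using V by (auto simp: g_f)
    show "t i \<noteq> 1"
    proof (cases "i \<in> A")
      case True
      then have "g i (f t) < 1" using mem(2) by (simp add: U_def)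
      then show ?thesis using val by simp
    next
      case False
      then have "0 < g i (f s)" using mem(1) V(2) by (simp add: U_def)
      then show ?thesis using val by simp
    qed
  qed (use \<rho> in auto)
  then obtain t where t: "t \<in> cube ?k 1"
      "\<not> at_most ?k {V\<in>\<V>. \<exists>s\<in>W V \<inter> cube ?k 1. \<forall>i<?k. \<bar>s i - t i\<bar> \<le> \<rho> / 2}" by blast
  have "f t \<in> V" if "s \<in> W V" "\<forall>i<?k. \<bar>s i - t i\<bar> \<le> \<rho> / 2" for V s
  proof -
    have "\<bar>t i - s i\<bar> < \<rho>" if "i < ?k" for i
      using \<open>\<forall>i<?k. \<bar>s i - t i\<bar> \<le> \<rho> / 2\<close>[rule_format, OF that] \<rho>(1) by linarith
    then show ?thesis using that(1) t(1) by (simp add: W_def)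
  qed
  then have "at_most ?k {V\<in>\<V>. \<exists>s\<in>W V \<inter> cube ?k 1. \<forall>i<?k. \<bar>s i - t i\<bar> \<le> \<rho> / 2}"
    by (intro at_most_subset[OF \<V>(3)[OF f_in[OF t(1)]]]) blast
  with t show False by blast
qed

text \<open>By counting: the \<open>(N + 1) ^ k\<close> points of a grid of mesh \<open>1 / N\<close> lie in one ball of radius
  \<open>k + 1\<close>, while a ball of radius \<open>1 / (2 * N)\<close> contains the image of at most one of them. An exponent
  \<open>s\<close> allows only a constant times \<open>N powr s\<close> balls, which is too few as soon as \<open>s + 1 < k\<close>.\<close>

lemma assouad_dim_infinite:
  assumes M: "Metric_space M d" and cubes: "\<And>k L. 0 < k \<Longrightarrow> 0 < L \<Longrightarrow> \<exists>f g. lipschitz_cube M d k L f g"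
  shows "assouad_dim M d = \<infinity>"
  unfolding assouad_dim_def
proof (intro Inf_ennreal_eq_infinity notI)
  fix s :: real
  interpret Metric_space M d by fact
  assume "0 \<le> s \<and> (\<exists>C>0. \<forall>r R. 0 < r \<and> r < R \<longrightarrow> (\<forall>x\<in>M. \<exists>F\<subseteq>M. finite F \<and>
        real (card F) \<le> C * (R / r) powr s \<and> mball x R \<subseteq> (\<Union>y\<in>F. mball y r)))"
  then obtain C where s: "0 \<le> s" and C: "0 < C" and
    bound: "\<forall>r R. 0 < r \<and> r < R \<longrightarrow> (\<forall>x\<in>M. \<exists>F\<subseteq>M. finite F \<and>
        real (card F) \<le> C * (R / r) powr s \<and> mball x R \<subseteq> (\<Union>y\<in>F. mball y r))"
    by (elim exE conjE)
  have balls: "\<exists>F\<subseteq>M. finite F \<and> real (card F) \<le> C * (R / r) powr s \<and> mball x R \<subseteq> (\<Union>y\<in>F. mball y r)"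
    if "0 < r" "r < R" "x \<in> M" for r R x
    using bound that by simp
  obtain k :: nat where k: "s + 1 < k" using reals_Archimedean2 by blast
  then have "0 < k" using s by (intro gr0I) auto
  then obtain f g where "lipschitz_cube M d k 1 f g"
    using cubes[of k 1] by auto
  then interpret lipschitz_cube M d k 1 f g .
  define C' where "C' = C * (2 * (real k + 1)) powr s"
  obtain N :: nat where N: "max C' 1 < N" using reals_Archimedean2 by blast
  define pt where "pt x = (\<lambda>i. real (x i) / N)" for x :: "nat \<Rightarrow> nat"
  define G where "G = PiE {..<k} (\<lambda>_. {0..N})"
  have pt: "pt x \<in> cube k 1" if "x \<in> G" for x
    using that N by (auto simp: cube_def pt_def G_def PiE_iff divide_le_eq)
  have zero: "(\<lambda>_. 0) \<in> cube k 1" by (simp add: cube_def)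
  have "1 / (2 * real N) \<le> 1" using N by simp
  then have "0 < 1 / (2 * real N)" "1 / (2 * real N) < real k + 1"
    using N k_pos by (simp, linarith)
  from balls[OF this f_in[OF zero]] obtain F where F: "F \<subseteq> M" "finite F"
      "real (card F) \<le> C * ((real k + 1) / (1 / (2 * real N))) powr s"
      "mball (f (\<lambda>_. 0)) (real k + 1) \<subseteq> (\<Union>y\<in>F. mball y (1 / (2 * real N)))"
    by (elim exE conjE)
  have "\<exists>y\<in>F. f (pt x) \<in> mball y (1 / (2 * real N))" if x: "x \<in> G" for x
  proof -
    have "d (f (\<lambda>_. 0)) (f (pt x)) \<le> real k * 1"
      using pt[OF x] by (intro f_upper zero) (auto simp: cube_def)
    then show ?thesis using F(4) f_in[OF zero] f_in[OF pt[OF x]] by force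
  qed
  then obtain y where y: "\<And>x. x \<in> G \<Longrightarrow> y x \<in> F \<and> f (pt x) \<in> mball (y x) (1 / (2 * real N))"
    by metis
  have "inj_on y G"
  proof (rule inj_onI)
    fix u v assume uv: "u \<in> G" "v \<in> G" "y u = y v"
    have "u i = v i" if i: "i < k" for i
    proof -
      have "\<bar>g i (y u) - pt u i\<bar> < 1 / (2 * real N)" "\<bar>g i (y u) - pt v i\<bar> < 1 / (2 * real N)"
        using g_lipschitz[of "y u" "f (pt u)" i] g_lipschitz[of "y u" "f (pt v)" i]
          y[OF uv(1)] y[OF uv(2)] uv i g_f[OF pt[OF uv(1)] i] g_f[OF pt[OF uv(2)] i] by auto
      then have "\<bar>pt u i - pt v i\<bar> < 1 / (2 * real N) + 1 / (2 * real N)" by linarith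
      also have "\<dots> = 1 / N" by simp
      finally have "\<bar>real (u i) - real (v i)\<bar> / N < 1 / N"
        by (simp add: pt_def diff_divide_distrib[symmetric])
      then have "\<bar>real (u i) - real (v i)\<bar> < 1"
        using N by (simp add: divide_less_cancel)
      then show ?thesis by linarith
    qed
    then show "u = v" using uv by (auto simp: G_def intro: PiE_ext)
  qed
  then have "card G \<le> card F"
    using y F(2) by (intro card_inj_on_le[of y]) auto
  moreover have "card G = (N + 1) ^ k" by (simp add: G_def card_PiE)
  ultimately have "real N ^ k \<le> card F"
    by (metis (no_types, lifting) le_add1 of_nat_le_iff of_nat_power order_trans power_mono zero_le)
  also have "\<dots> \<le> C * (2 * (real k + 1) * N) powr s"
    using F(3) by (simp add: mult_ac)
  also have "\<dots> = C' * N powr s" by (simp add: C'_def powr_mult)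
  also have "\<dots> < N * N powr s" using N by (intro mult_strict_right_mono) auto
  also have "\<dots> = N powr (s + 1)" using N by (simp add: powr_add)
  also have "\<dots> \<le> N powr k" using N k by (intro powr_mono) auto
  also have "\<dots> = real N ^ k" using N by (simp add: powr_realpow)
  finally show False by simp
qed

text \<open>By volume: a set of diameter \<open>\<delta>\<close> meets the unit cube inside a box of side \<open>2 * \<delta>\<close>, so a countable
  cover satisfies \<open>1 \<le> 2 ^ k * (\<Sum>i. \<delta> i ^ k)\<close>. Diameters at most \<open>1\<close> and \<open>s < k\<close> give
  \<open>\<delta> i ^ k \<le> \<delta> i powr s\<close>, hence a positive lower bound for the \<open>s\<close>-dimensional content.\<close>

lemma hausdorff_dim_infinite:
  assumes cubes: "\<And>k L. 0 < k \<Longrightarrow> 0 < L \<Longrightarrow> \<exists>f g. lipschitz_cube M d k L f g"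
  shows "hausdorff_dim M d = \<infinity>"
  unfolding hausdorff_dim_def
proof (intro Inf_ennreal_eq_infinity notI)
  fix s :: real
  assume "0 \<le> s \<and> hausdorff_measure M d s = 0"
  then have s: "0 \<le> s" and null: "hausdorff_measure M d s = 0" by auto
  have content: "hausdorff_content M d s 1 \<le> 0"
    unfolding null[symmetric] hausdorff_measure_def by (rule SUP_upper) simp
  obtain k :: nat where k: "s < k" using reals_Archimedean2 by blast
  then have "0 < k" using s by (intro gr0I) auto
  then obtain f g where "lipschitz_cube M d k 1 f g"
    using cubes[of k 1] by auto
  then interpret lipschitz_cube M d k 1 f g .
  have "hausdorff_content M d s 1 < ennreal ((1 / 2) ^ k)"
    using content by simp
  then obtain U :: "nat \<Rightarrow> 'a set" where cover: "(\<Union>i. U i) = M" and diam: "\<And>i. ediam d (U i) \<le> ennreal 1"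
      and small: "(\<Sum>i. hausdorff_gauge d s (U i)) < ennreal ((1 / 2) ^ k)"
    unfolding hausdorff_content_def INF_less_iff by auto
  define \<delta> where "\<delta> i = enn2real (ediam d (U i))" for i
  have \<delta>: "ediam d (U i) = ennreal (\<delta> i)" "0 \<le> \<delta> i" "\<delta> i \<le> 1" for i
  proof -
    have fin: "ediam d (U i) < \<infinity>" using diam[of i] by (metis ennreal_less_top infinity_ennreal_def le_less_trans)
    then show "ediam d (U i) = ennreal (\<delta> i)" "0 \<le> \<delta> i" by (simp_all add: \<delta>_def)
    then show "\<delta> i \<le> 1" using diam[of i] by simp
  qed
  interpret P: product_sigma_finite "\<lambda>_::nat. lborel :: real measure" ..
  let ?P = "PiM {..<k} (\<lambda>_. lborel) :: (nat \<Rightarrow> real) measure"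
  have box: "emeasure ?P (PiE {..<k} (\<lambda>i. {a i..a i + b})) = ennreal (b ^ k)" if "0 \<le> b" for a :: "nat \<Rightarrow> real" and b
    using that by (subst P.emeasure_PiM) (auto simp: ennreal_power)
  define Q where "Q = PiE {..<k} (\<lambda>_. {0..1::real})"
  have Q: "Q \<subseteq> cube k 1"
  proof
    fix t assume "t \<in> Q"
    then have "t i \<in> {0..1}" if "i < k" for i
      using PiE_mem[of t "{..<k}" "\<lambda>_. {0..1}" i] that by (simp only: Q_def lessThan_iff)
    then show "t \<in> cube k 1" unfolding cube_def by fastforce
  qed
  have "\<exists>B. B \<in> sets ?P \<and> {t\<in>Q. f t \<in> U i} \<subseteq> B \<and> emeasure ?P B \<le> ennreal (2 ^ k) * hausdorff_gauge d s (U i)" for i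
  proof (cases "\<exists>c\<in>Q. f c \<in> U i")
    case False
    then show ?thesis by (intro exI[of _ "{}"]) auto
  next
    case True
    then obtain c where c: "c \<in> Q" "f c \<in> U i" by blast
    define B where "B = PiE {..<k} (\<lambda>j. {c j - \<delta> i..(c j - \<delta> i) + 2 * \<delta> i})"
    have "{t\<in>Q. f t \<in> U i} \<subseteq> B"
    proof clarify
      fix t assume t: "t \<in> Q" "f t \<in> U i"
      have "\<bar>t j - c j\<bar> \<le> \<delta> i" if "j < k" for j
        using coordinate_le_diam[of "U i" "\<delta> i" t c j] \<delta> Q c t that by auto
      then have "t j \<in> {c j - \<delta> i..(c j - \<delta> i) + 2 * \<delta> i}" if "j < k" for j
        using that by (fastforce simp: abs_le_iff)
      then show "t \<in> B" using t(1) unfolding B_def Q_def by (auto simp: PiE_iff)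
    qed
    moreover have "B \<in> sets ?P" unfolding B_def by (intro sets_PiM_I_finite) auto
    moreover have "emeasure ?P B \<le> ennreal (2 ^ k) * hausdorff_gauge d s (U i)"
    proof -
      have "emeasure ?P B = ennreal ((2 * \<delta> i) ^ k)"
        unfolding B_def using \<delta> by (intro box) auto
      also have "\<dots> = ennreal (2 ^ k) * ennreal (\<delta> i ^ k)"
        by (simp add: power_mult_distrib ennreal_mult \<delta>)
      also have "ennreal (\<delta> i ^ k) \<le> hausdorff_gauge d s (U i)"
      proof (cases "s = 0")
        case True
        then show ?thesis using c \<delta>(2,3)[of i] by (auto simp: hausdorff_gauge_def power_le_one)
      next
        case False
        have "\<delta> i ^ k \<le> \<delta> i powr s"
        proof (cases "\<delta> i = 0")
          case True
          then show ?thesis using k_pos by (simp add: zero_power)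
        next
          case False
          then have "\<delta> i ^ k = \<delta> i powr k" using \<delta>(2)[of i] by (simp add: powr_realpow)
          also have "\<dots> \<le> \<delta> i powr s" using \<delta>(2,3)[of i] k by (intro powr_mono') auto
          finally show ?thesis .
        qed
        then show ?thesis
          using c False \<delta>(1)[of i] \<delta>(2)[of i] by (auto simp: hausdorff_gauge_def epowr_def intro: ennreal_leI)
      qed
      finally show ?thesis by (simp add: mult_left_mono)
    qed
    ultimately show ?thesis by blast
  qed
  then have "\<forall>i. \<exists>B. B \<in> sets ?P \<and> {t\<in>Q. f t \<in> U i} \<subseteq> B \<and>
      emeasure ?P B \<le> ennreal (2 ^ k) * hausdorff_gauge d s (U i)" ..
  from choice[OF this] obtain B where "\<forall>i. B i \<in> sets ?P \<and> {t\<in>Q. f t \<in> U i} \<subseteq> B i \<and>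
      emeasure ?P (B i) \<le> ennreal (2 ^ k) * hausdorff_gauge d s (U i)" ..
  then have B: "\<And>i. B i \<in> sets ?P" "\<And>i. {t\<in>Q. f t \<in> U i} \<subseteq> B i"
      "\<And>i. emeasure ?P (B i) \<le> ennreal (2 ^ k) * hausdorff_gauge d s (U i)"
    by simp_all
  have "Q \<subseteq> (\<Union>i. B i)" using f_in Q B(2) cover by blast
  have "1 = emeasure ?P Q"
    using box[of 1 "\<lambda>_. 0"] by (simp add: Q_def)
  also have "\<dots> \<le> emeasure ?P (\<Union>i. B i)"
    using \<open>Q \<subseteq> (\<Union>i. B i)\<close> B(1) by (intro emeasure_mono) auto
  also have "\<dots> \<le> (\<Sum>i. emeasure ?P (B i))"
    using B(1) by (intro emeasure_subadditive_countably) auto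
  also have "\<dots> \<le> (\<Sum>i. ennreal (2 ^ k) * hausdorff_gauge d s (U i))"
    by (intro suminf_le B(3)) auto
  also have "\<dots> = ennreal (2 ^ k) * (\<Sum>i. hausdorff_gauge d s (U i))" by simp
  also have "\<dots> < ennreal (2 ^ k) * ennreal ((1 / 2) ^ k)"
    using small by (intro ennreal_mult_strict_left_mono) auto
  also have "\<dots> = 1" by (simp flip: ennreal_mult power_mult_distrib)
  finally show False by simp
qed

section \<open>The metric on diagrams\<close>

text \<open>Replacing the infimum defining the distance by the existence of one matching turns sums of
  distances into sums of budgets \<open>c\<close>.\<close>

definition matching :: "real \<Rightarrow> real \<Rightarrow> 'a::metric_space cmset \<Rightarrow> 'a cmset \<Rightarrow> bool" where
  "matching p c \<sigma> \<tau> \<longleftrightarrow> (\<exists>\<phi>. bij_betw \<phi> (cm_points \<sigma>) (cm_points \<tau>) \<and>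
     matching_cost p \<sigma> \<phi> \<le> ennreal (c powr p))"

lemma epowr_le_iff:
  assumes "0 < p" "0 \<le> c"
  shows "epowr x (1 / p) \<le> ennreal c \<longleftrightarrow> x \<le> ennreal (c powr p)"
proof (cases x rule: ennreal_cases)
  case (real r)
  have "r powr (1 / p) \<le> c \<longleftrightarrow> r \<le> c powr p"
  proof
    assume "r powr (1 / p) \<le> c"
    then have "(r powr (1 / p)) powr p \<le> c powr p" using assms by (intro powr_mono2) auto
    then show "r \<le> c powr p" using real assms by (simp add: powr_powr)
  next
    assume "r \<le> c powr p"
    then have "r powr (1 / p) \<le> (c powr p) powr (1 / p)" using assms real by (intro powr_mono2) auto
    then show "r powr (1 / p) \<le> c" using real assms by (simp add: powr_powr)
  qed
  then show ?thesis using real assms by (simp add: epowr_def ennreal_le_iff)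
next
  case top
  then show ?thesis by (simp add: epowr_def top_unique)
qed

lemma matching_imp_cm_dist_le:
  assumes "0 < p" "0 \<le> c" "matching p c \<sigma> \<tau>"
  shows "cm_dist p \<sigma> \<tau> \<le> ennreal c"
  using assms unfolding matching_def cm_dist_def
  by (auto intro!: INF_lower2 simp: epowr_le_iff)

lemma cm_dist_less_imp_matching:
  assumes "0 < p" "0 \<le> c" "cm_dist p \<sigma> \<tau> < ennreal c"
  shows "matching p c \<sigma> \<tau>"
  using assms unfolding matching_def cm_dist_def INF_less_iff
  by (auto simp: epowr_le_iff[symmetric] intro: less_imp_le)

lemma matching_sym:
  assumes "matching p c \<sigma> \<tau>" shows "matching p c \<tau> \<sigma>"
proof -
  obtain \<phi> where \<phi>: "bij_betw \<phi> (cm_points \<sigma>) (cm_points \<tau>)" "matching_cost p \<sigma> \<phi> \<le> ennreal (c powr p)"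
    using assms by (auto simp: matching_def)
  let ?\<psi> = "inv_into (cm_points \<sigma>) \<phi>"
  have \<psi>: "bij_betw ?\<psi> (cm_points \<tau>) (cm_points \<sigma>)"
    using \<phi>(1) by (rule bij_betw_inv_into)
  have "matching_cost p \<tau> ?\<psi> =
      (\<Sum>\<^sub>\<infinity>e\<in>cm_points \<tau>. ennreal (dist (fst (?\<psi> e)) (fst (\<phi> (?\<psi> e))) powr p))"
    unfolding matching_cost_def
    by (intro infsum_cong) (simp add: bij_betw_inv_into_right[OF \<phi>(1)] dist_commute)
  also have "\<dots> = matching_cost p \<sigma> \<phi>"
    unfolding matching_cost_def by (rule infsum_reindex_bij_betw[OF \<psi>])
  finally show ?thesis using \<psi> \<phi>(2) unfolding matching_def by auto
qed

text \<open>Minkowski's inequality, for budgets \<open>A\<close> and \<open>B\<close> that may exceed the norms. It is convexity of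
  \<open>x powr p\<close>: divided by \<open>A + B\<close>, the sum \<open>a i + b i\<close> is the convex combination of \<open>a i / A\<close> and
  \<open>b i / B\<close> with weights \<open>A / (A + B)\<close> and \<open>B / (A + B)\<close>. Strict positivity of the budgets avoids
  dividing by a vanishing norm.\<close>

lemma minkowski_infsum:
  fixes a b :: "'i \<Rightarrow> real"
  assumes p: "1 \<le> p" and A: "0 < A" and B: "0 < B" and a: "\<And>i. 0 \<le> a i" and b: "\<And>i. 0 \<le> b i"
    and sa: "(\<Sum>\<^sub>\<infinity>i\<in>I. ennreal (a i powr p)) \<le> ennreal (A powr p)"
    and sb: "(\<Sum>\<^sub>\<infinity>i\<in>I. ennreal (b i powr p)) \<le> ennreal (B powr p)"
  shows "(\<Sum>\<^sub>\<infinity>i\<in>I. ennreal ((a i + b i) powr p)) \<le> ennreal ((A + B) powr p)"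
proof (rule infsum_le_finite_sums)
  fix F assume F: "finite F" "F \<subseteq> I"
  have part: "(\<Sum>i\<in>F. c i powr p) \<le> K powr p"
    if "(\<Sum>\<^sub>\<infinity>i\<in>I. ennreal (c i powr p)) \<le> ennreal (K powr p)" for c :: "'i \<Rightarrow> real" and K
  proof -
    have "ennreal (\<Sum>i\<in>F. c i powr p) = (\<Sum>\<^sub>\<infinity>i\<in>F. ennreal (c i powr p))"
      using F by (simp add: sum_ennreal)
    also have "\<dots> \<le> (\<Sum>\<^sub>\<infinity>i\<in>I. ennreal (c i powr p))"
      using F by (intro infsum_mono_neutral nonneg_summable_on_complete) auto
    also note that
    finally show ?thesis by (simp add: ennreal_le_iff)
  qed
  \<comment> \<open>Convexity on the open half-line, extended to \<open>0\<close>, where it becomes \<open>w powr p \<le> w\<close> for \<open>w \<le> 1\<close>.\<close>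
  have convex: "(u * x + v * y) powr p \<le> u * x powr p + v * y powr p"
    if "0 \<le> x" "0 \<le> y" "0 < u" "0 < v" "u + v = 1" for u v x y :: real
  proof (cases "x = 0 \<or> y = 0")
    case True
    have small: "w powr p \<le> w" if "0 \<le> w" "w \<le> 1" for w :: real
      using powr_mono'[of 1 p w] p that by (cases "w = 0") auto
    from True show ?thesis
      using small[of u] small[of v] that p
      by (auto simp: powr_mult intro!: mult_right_mono)
  next
    case False
    have u: "u = 1 - v" using that by simp
    show ?thesis
      unfolding u using convex_onD[OF powr_convex[OF p], of v x y] that False by simp
  qed
  define u where "u = A / (A + B)"
  define v where "v = B / (A + B)"
  have uv: "0 < u" "0 < v" "u + v = 1"
    using A B by (simp_all add: u_def v_def divide_simps)
  have "(a i + b i) powr p \<le> (A + B) powr p * (u * (a i powr p / A powr p) + v * (b i powr p / B powr p))" for i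
  proof -
    have "a i + b i = (A + B) * (u * (a i / A) + v * (b i / B))"
      using A B by (simp add: u_def v_def divide_simps)
    then have "(a i + b i) powr p = (A + B) powr p * (u * (a i / A) + v * (b i / B)) powr p"
      using A B a[of i] b[of i] uv by (simp add: powr_mult)
    also have "(u * (a i / A) + v * (b i / B)) powr p \<le> u * (a i / A) powr p + v * (b i / B) powr p"
      using a[of i] b[of i] A B uv by (intro convex) auto
    finally show ?thesis
      using a[of i] b[of i] A B by (simp add: powr_divide mult_left_mono)
  qed
  then have "(\<Sum>i\<in>F. (a i + b i) powr p) \<le>
      (\<Sum>i\<in>F. (A + B) powr p * (u * (a i powr p / A powr p) + v * (b i powr p / B powr p)))"
    by (intro sum_mono)
  also have "\<dots> = (A + B) powr p *
      (u * ((\<Sum>i\<in>F. a i powr p) / A powr p) + v * ((\<Sum>i\<in>F. b i powr p) / B powr p))"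
    by (simp only: distrib_left sum.distrib sum_distrib_left sum_divide_distrib)
  also have "\<dots> \<le> (A + B) powr p * (u * 1 + v * 1)"
    using uv part[OF sa] part[OF sb] A B
    by (intro mult_left_mono add_mono) (auto simp: divide_le_eq)
  finally have "(\<Sum>i\<in>F. (a i + b i) powr p) \<le> (A + B) powr p"
    using uv by simp
  then show "(\<Sum>i\<in>F. ennreal ((a i + b i) powr p)) \<le> ennreal ((A + B) powr p)"
    by (simp add: sum_ennreal ennreal_leI)
qed (simp add: nonneg_summable_on_complete)

lemma matching_trans:
  assumes p: "1 \<le> p" and "0 < A" "0 < B" and "matching p A \<sigma> \<tau>" "matching p B \<tau> \<rho>"
  shows "matching p (A + B) \<sigma> \<rho>"
proof -
  obtain \<phi> \<psi> where \<phi>: "bij_betw \<phi> (cm_points \<sigma>) (cm_points \<tau>)" "matching_cost p \<sigma> \<phi> \<le> ennreal (A powr p)"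
    and \<psi>: "bij_betw \<psi> (cm_points \<tau>) (cm_points \<rho>)" "matching_cost p \<tau> \<psi> \<le> ennreal (B powr p)"
    using assms by (auto simp: matching_def)
  have "matching_cost p \<sigma> (\<psi> \<circ> \<phi>) \<le> (\<Sum>\<^sub>\<infinity>e\<in>cm_points \<sigma>.
      ennreal ((dist (fst e) (fst (\<phi> e)) + dist (fst (\<phi> e)) (fst (\<psi> (\<phi> e)))) powr p))"
    unfolding matching_cost_def using p
    by (intro infsum_mono nonneg_summable_on_complete ennreal_leI powr_mono2) (auto simp: dist_triangle)
  also have "\<dots> \<le> ennreal ((A + B) powr p)"
  proof (rule minkowski_infsum[OF p \<open>0 < A\<close> \<open>0 < B\<close>])
    show "(\<Sum>\<^sub>\<infinity>e\<in>cm_points \<sigma>. ennreal (dist (fst e) (fst (\<phi> e)) powr p)) \<le> ennreal (A powr p)"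
      using \<phi>(2) by (simp add: matching_cost_def)
    have "(\<Sum>\<^sub>\<infinity>e\<in>cm_points \<sigma>. ennreal (dist (fst (\<phi> e)) (fst (\<psi> (\<phi> e))) powr p)) = matching_cost p \<tau> \<psi>"
      unfolding matching_cost_def by (rule infsum_reindex_bij_betw[OF \<phi>(1)])
    then show "(\<Sum>\<^sub>\<infinity>e\<in>cm_points \<sigma>. ennreal (dist (fst (\<phi> e)) (fst (\<psi> (\<phi> e))) powr p)) \<le> ennreal (B powr p)"
      using \<psi>(2) by simp
  qed auto
  finally show ?thesis
    using bij_betw_trans[OF \<phi>(1) \<psi>(1)] unfolding matching_def by blast
qed

lemma matching_add:
  assumes "0 < p" "0 \<le> c" "c < c'" "matching p c \<sigma> \<tau>"
  shows "matching p c' (\<sigma> \<oplus>\<^sub>m \<gamma>) (\<tau> \<oplus>\<^sub>m \<gamma>)"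
proof (rule cm_dist_less_imp_matching)
  have "cm_dist p (\<sigma> \<oplus>\<^sub>m \<gamma>) (\<tau> \<oplus>\<^sub>m \<gamma>) \<le> cm_dist p \<sigma> \<tau>" by (rule cm_dist_add_le)
  also have "\<dots> \<le> ennreal c" using assms by (intro matching_imp_cm_dist_le) auto
  also have "\<dots> < ennreal c'" using assms by (simp add: ennreal_less_iff)
  finally show "cm_dist p (\<sigma> \<oplus>\<^sub>m \<gamma>) (\<tau> \<oplus>\<^sub>m \<gamma>) < ennreal c'" .
qed (use assms in auto)

lemma matching_single_dist:
  assumes "0 < p" "0 \<le> c" "bij_betw \<phi> (cm_points \<sigma>) (cm_points \<tau>)"
    "matching_cost p \<sigma> \<phi> \<le> ennreal (c powr p)" "e \<in> cm_points \<sigma>"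
  shows "dist (fst e) (fst (\<phi> e)) \<le> c"
proof -
  have "ennreal (dist (fst e) (fst (\<phi> e)) powr p) =
      (\<Sum>\<^sub>\<infinity>e\<in>{e}. ennreal (dist (fst e) (fst (\<phi> e)) powr p))" by simp
  also have "\<dots> \<le> matching_cost p \<sigma> \<phi>"
    unfolding matching_cost_def using assms
    by (intro infsum_mono_neutral nonneg_summable_on_complete) auto
  also note assms(4)
  finally have "dist (fst e) (fst (\<phi> e)) powr p \<le> c powr p" by (simp add: ennreal_le_iff)
  then show ?thesis using assms(1,2) by (metis linorder_not_le powr_less_mono2 zero_le_dist)
qed

lemma diagrams_rep:
  assumes "S \<in> diagrams A"
  obtains \<sigma> where "\<sigma> \<in> cmsets UNIV" "S = diagram_rel A `` {\<sigma>}"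
  using assms unfolding diagrams_def by (elim quotientE)

lemma matching_of_diagram_dist_less:
  assumes p: "0 < p" and "0 \<le> c" and "\<sigma> \<in> cmsets UNIV" "\<tau> \<in> cmsets UNIV"
    and "diagram_dist p A (diagram_rel A `` {\<sigma>}) (diagram_rel A `` {\<tau>}) < ennreal c"
  obtains \<alpha> \<beta> where "\<alpha> \<in> cmsets A" "\<beta> \<in> cmsets A" "matching p c (\<sigma> \<oplus>\<^sub>m \<alpha>) (\<tau> \<oplus>\<^sub>m \<beta>)"
  using assms by (auto simp: diagram_dist_class INF_less_iff intro: cm_dist_less_imp_matching)

lemma diagram_dist_le:
  assumes p: "0 < p" and "0 \<le> c" and "\<sigma> \<in> cmsets UNIV" "\<tau> \<in> cmsets UNIV"
    "\<alpha> \<in> cmsets A" "\<beta> \<in> cmsets A" "matching p c (\<sigma> \<oplus>\<^sub>m \<alpha>) (\<tau> \<oplus>\<^sub>m \<beta>)"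
  shows "diagram_dist p A (diagram_rel A `` {\<sigma>}) (diagram_rel A `` {\<tau>}) \<le> ennreal c"
proof -
  have "(INF \<alpha>\<in>cmsets A. INF \<beta>\<in>cmsets A. cm_dist p (\<sigma> \<oplus>\<^sub>m \<alpha>) (\<tau> \<oplus>\<^sub>m \<beta>)) \<le> cm_dist p (\<sigma> \<oplus>\<^sub>m \<alpha>) (\<tau> \<oplus>\<^sub>m \<beta>)"
    using assms by (intro INF2_lower)
  also have "\<dots> \<le> ennreal c" using assms by (intro matching_imp_cm_dist_le)
  finally show ?thesis using assms by (simp add: diagram_dist_class)
qed

lemma cm_dist_commute:
  assumes "0 < p" shows "cm_dist p \<sigma> \<tau> = cm_dist p \<tau> \<sigma>"
proof -
  have "cm_dist p \<tau> \<sigma> \<le> cm_dist p \<sigma> \<tau>" for \<sigma> \<tau> :: "'a cmset"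
  proof (rule ennreal_le_epsilon)
    fix e :: real assume e: "cm_dist p \<sigma> \<tau> < top" "0 < e"
    then obtain r where r: "cm_dist p \<sigma> \<tau> = ennreal r" "0 \<le> r" by (cases "cm_dist p \<sigma> \<tau>") auto
    then have "matching p (r + e) \<sigma> \<tau>"
      using e assms by (intro cm_dist_less_imp_matching) (auto simp: ennreal_less_iff)
    then have "matching p (r + e) \<tau> \<sigma>" by (rule matching_sym)
    then have "cm_dist p \<tau> \<sigma> \<le> ennreal (r + e)"
      using r e assms by (intro matching_imp_cm_dist_le) auto
    then show "cm_dist p \<tau> \<sigma> \<le> cm_dist p \<sigma> \<tau> + ennreal e" using r e by (simp add: ennreal_plus)
  qed
  from this[of \<sigma> \<tau>] this[of \<tau> \<sigma>] show ?thesis by (rule antisym)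
qed

lemma diagram_dist_commute:
  assumes "0 < p" shows "diagram_dist p A S T = diagram_dist p A T S"
proof -
  have "diagram_dist p A T S \<le> diagram_dist p A S T" for S T :: "'a cmset set"
    unfolding diagram_dist_def
  proof (intro INF_greatest)
    fix \<sigma> \<tau> \<alpha> \<beta> assume "\<sigma> \<in> S" "\<tau> \<in> T" "\<alpha> \<in> cmsets A" "\<beta> \<in> cmsets A"
    then show "(INF \<sigma>\<in>T. INF \<tau>\<in>S. INF \<alpha>\<in>cmsets A. INF \<beta>\<in>cmsets A. cm_dist p (\<sigma> \<oplus>\<^sub>m \<alpha>) (\<tau> \<oplus>\<^sub>m \<beta>))
        \<le> cm_dist p (\<sigma> \<oplus>\<^sub>m \<alpha>) (\<tau> \<oplus>\<^sub>m \<beta>)"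
      by (subst cm_dist_commute[OF assms])
        (intro INF_lower2[of \<tau> T] INF_lower2[of \<sigma> S] INF_lower2[of \<beta>] INF_lower2[of \<alpha>] order_refl)
  qed
  from this[of S T] this[of T S] show ?thesis by (rule antisym)
qed

text \<open>Matchings of \<open>\<sigma> \<oplus>\<^sub>m \<alpha>\<close> with \<open>\<tau> \<oplus>\<^sub>m \<beta>\<close> and of \<open>\<tau> \<oplus>\<^sub>m \<gamma>\<close> with \<open>\<rho> \<oplus>\<^sub>m \<delta>\<close> compose after adding
  \<open>\<gamma>\<close> to the first and \<open>\<beta>\<close> to the second, which makes the middle multisets equal. Adding a multiset
  is controlled only for the infimum, so each such step uses up a little of \<open>e\<close>.\<close>

lemma diagram_dist_triangle:
  assumes p: "1 \<le> p" and "S \<in> diagrams A" "T \<in> diagrams A" "R \<in> diagrams A"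
  shows "diagram_dist p A S R \<le> diagram_dist p A S T + diagram_dist p A T R"
proof -
  obtain \<sigma> \<tau> \<rho> where reps: "\<sigma> \<in> cmsets UNIV" "\<tau> \<in> cmsets UNIV" "\<rho> \<in> cmsets UNIV"
    and S: "S = diagram_rel A `` {\<sigma>}" and T: "T = diagram_rel A `` {\<tau>}" and R: "R = diagram_rel A `` {\<rho>}"
    using assms by (metis diagrams_rep)
  have p0: "0 < p" using p by simp
  show ?thesis
  proof (rule ennreal_le_epsilon)
    fix e :: real assume fin: "diagram_dist p A S T + diagram_dist p A T R < top" and e: "0 < e"
    then obtain a b where a: "diagram_dist p A S T = ennreal a" "0 \<le> a"
      and b: "diagram_dist p A T R = ennreal b" "0 \<le> b"
      by (cases "diagram_dist p A S T"; cases "diagram_dist p A T R") auto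
    obtain \<alpha> \<beta> where ab: "\<alpha> \<in> cmsets A" "\<beta> \<in> cmsets A" "matching p (a + e / 4) (\<sigma> \<oplus>\<^sub>m \<alpha>) (\<tau> \<oplus>\<^sub>m \<beta>)"
      using matching_of_diagram_dist_less[OF p0 _ reps(1,2), of "a + e / 4" A] a e S T by (auto simp: ennreal_less_iff)
    obtain \<gamma> \<delta> where cd: "\<gamma> \<in> cmsets A" "\<delta> \<in> cmsets A" "matching p (b + e / 4) (\<tau> \<oplus>\<^sub>m \<gamma>) (\<rho> \<oplus>\<^sub>m \<delta>)"
      using matching_of_diagram_dist_less[OF p0 _ reps(2,3), of "b + e / 4" A] b e T R by (auto simp: ennreal_less_iff)
    have "matching p (a + e / 2) (\<sigma> \<oplus>\<^sub>m \<alpha> \<oplus>\<^sub>m \<gamma>) (\<tau> \<oplus>\<^sub>m \<beta> \<oplus>\<^sub>m \<gamma>)"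
      using a e p0 ab(3) by (intro matching_add[where c = "a + e / 4"]) auto
    moreover have "matching p (b + e / 2) (\<tau> \<oplus>\<^sub>m \<gamma> \<oplus>\<^sub>m \<beta>) (\<rho> \<oplus>\<^sub>m \<delta> \<oplus>\<^sub>m \<beta>)"
      using b e p0 cd(3) by (intro matching_add[where c = "b + e / 4"]) auto
    moreover have "\<tau> \<oplus>\<^sub>m \<gamma> \<oplus>\<^sub>m \<beta> = \<tau> \<oplus>\<^sub>m \<beta> \<oplus>\<^sub>m \<gamma>"
      by (metis cm_add_assoc cm_add_commute)
    ultimately have "matching p ((a + e / 2) + (b + e / 2)) (\<sigma> \<oplus>\<^sub>m \<alpha> \<oplus>\<^sub>m \<gamma>) (\<rho> \<oplus>\<^sub>m \<delta> \<oplus>\<^sub>m \<beta>)"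
      using a b e
      by (intro matching_trans[OF p, where A = "a + e / 2" and B = "b + e / 2" and \<tau> = "\<tau> \<oplus>\<^sub>m \<beta> \<oplus>\<^sub>m \<gamma>"]) auto
    then have "diagram_dist p A S R \<le> ennreal (a + b + e)"
      unfolding S R using a b e p0 reps cmsets_add[OF ab(1) cd(1)] cmsets_add[OF cd(2) ab(2)]
      by (intro diagram_dist_le[where \<alpha> = "\<alpha> \<oplus>\<^sub>m \<gamma>" and \<beta> = "\<delta> \<oplus>\<^sub>m \<beta>"])
        (auto simp: cm_add_assoc algebra_simps)
    then show "diagram_dist p A S R \<le> diagram_dist p A S T + diagram_dist p A T R + ennreal e"
      using a b e by (simp add: ennreal_plus)
  qed
qed

lemma empty_diagram_in: "empty_diagram A \<in> diagrams A"
  unfolding empty_diagram_def diagrams_def by (intro quotientI cm_empty_in)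

lemma diagram_dist_finite:
  assumes p: "1 \<le> p" and S: "S \<in> pdiagrams p A" and T: "T \<in> pdiagrams p A"
  shows "diagram_dist p A S T < \<infinity>"
proof -
  have "diagram_dist p A S T \<le> diagram_dist p A S (empty_diagram A) + diagram_dist p A (empty_diagram A) T"
    using assms empty_diagram_in by (intro diagram_dist_triangle) (auto simp: pdiagrams_def)
  also have "\<dots> < \<infinity>"
    using p S T diagram_dist_commute[of p A "empty_diagram A" T] by (auto simp: pdiagrams_def)
  finally show ?thesis .
qed

text \<open>Each point of \<open>\<tau>\<close> near \<open>x\<close> has to be moved by at least half the distance of \<open>x\<close> to \<open>A\<close> when \<open>\<tau>\<close> is
  matched into \<open>A\<close>; a finite total cost permits only finitely many of them.\<close>

lemma support_isolated:
  assumes p: "1 \<le> p" and A: "closed A" "A \<noteq> {}" and x: "x \<notin> A"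
    and \<tau>: "\<tau> \<in> cmsets UNIV" and fin: "diagram_dist p A (diagram_rel A `` {\<tau>}) (empty_diagram A) < \<infinity>"
  obtains \<epsilon> where "0 < \<epsilon>" "\<And>y. \<tau> y \<noteq> 0 \<Longrightarrow> dist x y \<le> \<epsilon> \<Longrightarrow> y = x" "\<And>y. y \<in> A \<Longrightarrow> \<epsilon> < dist x y"
proof -
  have p0: "0 < p" using p by simp
  define r where "r = infdist x A"
  have r: "0 < r" unfolding r_def using A x by (simp add: infdist_pos_not_in_closed)
  obtain c where c: "0 \<le> c" "diagram_dist p A (diagram_rel A `` {\<tau>}) (diagram_rel A `` {cm_empty}) = ennreal c"
    using fin by (cases "diagram_dist p A (diagram_rel A `` {\<tau>}) (empty_diagram A)") (auto simp: empty_diagram_def)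
  obtain \<alpha> \<beta> where ab: "\<alpha> \<in> cmsets A" "\<beta> \<in> cmsets A" "matching p (c + 1) (\<tau> \<oplus>\<^sub>m \<alpha>) (cm_empty \<oplus>\<^sub>m \<beta>)"
    using matching_of_diagram_dist_less[OF p0 _ \<tau> cm_empty_in, of "c + 1" A] c by (auto simp: ennreal_less_iff)
  then obtain \<phi> where \<phi>: "bij_betw \<phi> (cm_points (\<tau> \<oplus>\<^sub>m \<alpha>)) (cm_points \<beta>)"
      "matching_cost p (\<tau> \<oplus>\<^sub>m \<alpha>) \<phi> \<le> ennreal ((c + 1) powr p)"
    by (auto simp: matching_def cm_add_def cm_empty_def)
  define B where "B = {y. \<tau> y \<noteq> 0 \<and> dist x y \<le> r / 2}"
  have far: "(r / 2) powr p \<le> dist y (fst (\<phi> (y, 0))) powr p" if y: "y \<in> B" for y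
  proof -
    have "(y, 0) \<in> cm_points (\<tau> \<oplus>\<^sub>m \<alpha>)"
      using y by (auto simp: B_def cm_points_def cm_add_def zero_enat_def[symmetric] zero_less_iff_neq_zero)
    then have "\<phi> (y, 0) \<in> cm_points \<beta>" using \<phi>(1) by (auto simp: bij_betw_def)
    then have "\<beta> (fst (\<phi> (y, 0))) \<noteq> 0" by (auto simp: cm_points_def)
    then have "fst (\<phi> (y, 0)) \<in> A" using ab(2) by (auto simp: cmsets_def)
    then have "r \<le> dist x (fst (\<phi> (y, 0)))" unfolding r_def by (rule infdist_le)
    also have "\<dots> \<le> dist x y + dist y (fst (\<phi> (y, 0)))" by (rule dist_triangle)
    finally have "r / 2 \<le> dist y (fst (\<phi> (y, 0)))" using y by (simp add: B_def)
    then show ?thesis using r p0 by (intro powr_mono2) auto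
  qed
  have bound: "real (card F) * (r / 2) powr p \<le> (c + 1) powr p" if F: "finite F" "F \<subseteq> B" for F
  proof -
    have "real (card F) * (r / 2) powr p = (\<Sum>y\<in>F. (r / 2) powr p)" by simp
    also have "\<dots> \<le> (\<Sum>y\<in>F. dist y (fst (\<phi> (y, 0))) powr p)"
      using far F by (intro sum_mono) auto
    finally have "ennreal (real (card F) * (r / 2) powr p) \<le> (\<Sum>y\<in>F. ennreal (dist y (fst (\<phi> (y, 0))) powr p))"
      by (simp add: sum_ennreal ennreal_leI)
    also have "\<dots> = (\<Sum>\<^sub>\<infinity>e\<in>(\<lambda>y. (y, 0)) ` F. ennreal (dist (fst e) (fst (\<phi> e)) powr p))"
      using F by (simp add: sum.reindex inj_on_def)
    also have "\<dots> \<le> matching_cost p (\<tau> \<oplus>\<^sub>m \<alpha>) \<phi>"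
      unfolding matching_cost_def using F
      by (intro infsum_mono_neutral nonneg_summable_on_complete)
        (auto simp: B_def cm_points_def cm_add_def zero_enat_def[symmetric] zero_less_iff_neq_zero)
    also note \<phi>(2)
    finally show ?thesis by (simp add: ennreal_le_iff)
  qed
  have "finite B"
  proof (rule ccontr)
    assume "infinite B"
    obtain n :: nat where n: "(c + 1) powr p / (r / 2) powr p < n" using reals_Archimedean2 by blast
    obtain F where F: "finite F" "F \<subseteq> B" "card F = n"
      using infinite_arbitrarily_large[OF \<open>infinite B\<close>] by blast
    have "0 < (r / 2) powr p" using r by simp
    then show False using bound[OF F(1,2)] n F(3) by (simp add: pos_divide_less_eq)
  qed
  \<comment> \<open>Half of each distance, so that the points of \<open>B\<close> other than \<open>x\<close> are strictly farther than \<open>\<epsilon>\<close>.\<close>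
  define \<epsilon> where "\<epsilon> = Min (insert (r / 2) ((\<lambda>y. dist x y / 2) ` (B - {x})))"
  have fin': "finite (insert (r / 2) ((\<lambda>y. dist x y / 2) ` (B - {x})))" using \<open>finite B\<close> by simp
  have "0 < \<epsilon>" unfolding \<epsilon>_def using fin' r by (subst Min_gr_iff) auto
  moreover have \<epsilon>r: "\<epsilon> \<le> r / 2" unfolding \<epsilon>_def using fin' by (intro Min_le) auto
  moreover have "y = x" if "\<tau> y \<noteq> 0" "dist x y \<le> \<epsilon>" for y
  proof (rule ccontr)
    assume "y \<noteq> x"
    then have "y \<in> B - {x}" using that \<epsilon>r by (simp add: B_def)
    then have "\<epsilon> \<le> dist x y / 2" unfolding \<epsilon>_def using fin' by (intro Min_le) auto
    then show False using that \<open>0 < \<epsilon>\<close> by simp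
  qed
  moreover have "\<epsilon> < dist x y" if "y \<in> A" for y
    using infdist_le[OF that, of x] \<epsilon>r r by (simp add: r_def)
  ultimately show thesis using that by blast
qed

text \<open>A matching whose cost is below the isolation radius of \<open>x\<close> must send every copy of \<open>x\<close> in \<open>\<sigma>\<close> to a
  copy of \<open>x\<close> in \<open>\<tau>\<close>. Isolation, and with it the positivity of the distance of different diagrams, may
  fail for diagrams at infinite distance from the empty one.\<close>

lemma multiplicity_le_of_dist_zero:
  assumes p: "1 \<le> p" and A: "closed A" "A \<noteq> {}" and x: "x \<notin> A"
    and \<sigma>: "\<sigma> \<in> cmsets UNIV" and \<tau>: "\<tau> \<in> cmsets UNIV"
    and fin: "diagram_dist p A (diagram_rel A `` {\<tau>}) (empty_diagram A) < \<infinity>"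
    and zero: "diagram_dist p A (diagram_rel A `` {\<sigma>}) (diagram_rel A `` {\<tau>}) = 0"
  shows "\<sigma> x \<le> \<tau> x"
proof (rule ccontr)
  have p0: "0 < p" using p by simp
  assume "\<not> \<sigma> x \<le> \<tau> x"
  then obtain n where n: "\<tau> x = enat n" "enat n < \<sigma> x" by (cases "\<tau> x") auto
  obtain \<epsilon> where \<epsilon>: "0 < \<epsilon>" "\<And>y. \<tau> y \<noteq> 0 \<Longrightarrow> dist x y \<le> \<epsilon> \<Longrightarrow> y = x" "\<And>y. y \<in> A \<Longrightarrow> \<epsilon> < dist x y"
    using support_isolated[OF p A x \<tau> fin] by blast
  obtain \<alpha> \<beta> where ab: "\<alpha> \<in> cmsets A" "\<beta> \<in> cmsets A" "matching p \<epsilon> (\<sigma> \<oplus>\<^sub>m \<alpha>) (\<tau> \<oplus>\<^sub>m \<beta>)"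
    using matching_of_diagram_dist_less[OF p0 _ \<sigma> \<tau>, of \<epsilon> A] \<epsilon>(1) zero by auto
  then obtain \<phi> where \<phi>: "bij_betw \<phi> (cm_points (\<sigma> \<oplus>\<^sub>m \<alpha>)) (cm_points (\<tau> \<oplus>\<^sub>m \<beta>))"
      "matching_cost p (\<sigma> \<oplus>\<^sub>m \<alpha>) \<phi> \<le> ennreal (\<epsilon> powr p)"
    by (auto simp: matching_def)
  have \<beta>x: "\<beta> x = 0" using ab(2) x by (auto simp: cmsets_def)
  define E where "E = Pair x ` {..n}"
  have E: "E \<subseteq> cm_points (\<sigma> \<oplus>\<^sub>m \<alpha>)"
  proof (clarsimp simp: E_def cm_points_def cm_add_def)
    fix i assume "i \<le> n"
    then have "enat i \<le> enat n" by simp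
    also note n(2)
    also have "\<sigma> x \<le> \<sigma> x + \<alpha> x" by simp
    finally show "enat i < \<sigma> x + \<alpha> x" .
  qed
  have "\<phi> ` E \<subseteq> Pair x ` {..<n}"
  proof (rule image_subsetI)
    fix e assume e: "e \<in> E"
    obtain y j where yj: "\<phi> e = (y, j)" by fastforce
    have "dist (fst e) (fst (\<phi> e)) \<le> \<epsilon>"
      by (rule matching_single_dist[OF p0 _ \<phi>]) (use E e \<epsilon>(1) in auto)
    then have d: "dist x y \<le> \<epsilon>" using e yj by (auto simp: E_def)
    have "\<phi> e \<in> cm_points (\<tau> \<oplus>\<^sub>m \<beta>)" using bij_betwE[OF \<phi>(1)] E e by blast
    then have "(y, j) \<in> cm_points (\<tau> \<oplus>\<^sub>m \<beta>)" by (simp only: yj)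
    then have j: "enat j < \<tau> y + \<beta> y" by (simp add: cm_points_def cm_add_def)
    have "y \<notin> A" using \<epsilon>(3)[of y] d by auto
    then have "\<beta> y = 0" using ab(2) by (auto simp: cmsets_def)
    then have "\<tau> y \<noteq> 0" using j by auto
    then have "y = x" using \<epsilon>(2) d by blast
    with j n \<beta>x show "\<phi> e \<in> Pair x ` {..<n}" by (simp add: yj)
  qed
  moreover have "inj_on \<phi> E" using \<phi>(1) E by (auto simp: bij_betw_def intro: inj_on_subset)
  ultimately have "card E \<le> card (Pair x ` {..<n})" by (intro card_inj_on_le) auto
  then show False by (simp add: E_def card_image inj_on_def)
qed

text \<open>Diagrams at distance \<open>0\<close> have representatives that agree off \<open>A\<close>; exchanging their restrictions
  to \<open>A\<close> shows that they are equivalent.\<close>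

theorem Metric_space_pdiagrams:
  assumes p: "1 \<le> p" and A: "closed A" "A \<noteq> {}"
  shows "Metric_space (pdiagrams p A) (pdiagram_dist p A)"
proof
  have p0: "0 < p" using p by simp
  fix S T R :: "'a cmset set"
  show "0 \<le> pdiagram_dist p A S T" by (simp add: pdiagram_dist_def)
  show "pdiagram_dist p A S T = pdiagram_dist p A T S"
    unfolding pdiagram_dist_def by (subst diagram_dist_commute[OF p0]) (rule refl)
  assume S: "S \<in> pdiagrams p A" and T: "T \<in> pdiagrams p A"
  obtain \<sigma> \<tau> where reps: "\<sigma> \<in> cmsets UNIV" "\<tau> \<in> cmsets UNIV"
    and S': "S = diagram_rel A `` {\<sigma>}" and T': "T = diagram_rel A `` {\<tau>}"
  proof -
    have "S \<in> diagrams A" "T \<in> diagrams A" using S T by (auto simp: pdiagrams_def)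
    then show thesis by (elim diagrams_rep) (rule that)
  qed
  show "pdiagram_dist p A S T = 0 \<longleftrightarrow> S = T"
  proof
    assume "pdiagram_dist p A S T = 0"
    then have zero: "diagram_dist p A S T = 0"
      using diagram_dist_finite[OF p S T] by (auto simp: pdiagram_dist_def enn2real_eq_0_iff)
    then have "diagram_dist p A T S = 0" by (subst diagram_dist_commute[OF p0])
    then have eq: "\<sigma> x = \<tau> x" if "x \<notin> A" for x
      using zero S T reps that unfolding S' T' pdiagrams_def
      by (intro antisym multiplicity_le_of_dist_zero[OF p A]) auto
    define on_A where "on_A \<rho> = (\<lambda>x. if x \<in> A then \<rho> x else 0)" for \<rho> :: "'a cmset"
    have on_A: "on_A \<rho> \<in> cmsets A" if "\<rho> \<in> cmsets UNIV" for \<rho>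
      using that by (auto simp: on_A_def cmsets_def elim!: countable_subset[rotated] split: if_splits)
    have "\<sigma> \<oplus>\<^sub>m on_A \<tau> = \<tau> \<oplus>\<^sub>m on_A \<sigma>"
      using eq by (auto simp: cm_add_def on_A_def add.commute)
    then have "(\<sigma>, \<tau>) \<in> diagram_rel A"
      using reps on_A unfolding diagram_rel_def by blast
    then show "S = T" unfolding S' T' by (rule equiv_class_eq[OF equiv_diagram_rel])
  next
    assume "S = T"
    have "matching p 0 (\<sigma> \<oplus>\<^sub>m cm_empty) (\<sigma> \<oplus>\<^sub>m cm_empty)"
      unfolding matching_def by (intro exI[of _ id]) (use p0 in \<open>auto simp: matching_cost_def\<close>)
    then have "diagram_dist p A S S \<le> ennreal 0"
      unfolding S' using reps p0 cm_empty_in by (intro diagram_dist_le) auto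
    then show "pdiagram_dist p A S T = 0" using \<open>S = T\<close> by (simp add: pdiagram_dist_def)
  qed
  assume R: "R \<in> pdiagrams p A"
  have "diagram_dist p A S R \<le> diagram_dist p A S T + diagram_dist p A T R"
    using p S T R by (intro diagram_dist_triangle) (auto simp: pdiagrams_def)
  then have "enn2real (diagram_dist p A S R) \<le> enn2real (diagram_dist p A S T + diagram_dist p A T R)"
    using diagram_dist_finite[OF p] S T R by (intro enn2real_mono) (auto simp: less_top[symmetric])
  then show "pdiagram_dist p A S R \<le> pdiagram_dist p A S T + pdiagram_dist p A T R"
    using diagram_dist_finite[OF p S T] diagram_dist_finite[OF p T R]
    by (simp add: pdiagram_dist_def enn2real_plus)
qed

section \<open>Cubes of diagrams\<close>

text \<open>The largest value of \<open>h\<close> on a diagram. Every representative may be enlarged by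
  points of \<open>A\<close>, so only a value that takes all of \<open>A\<close> into account can be the same for all of them.\<close>

definition height :: "'a set \<Rightarrow> ('a \<Rightarrow> real) \<Rightarrow> 'a cmset set \<Rightarrow> real" where
  "height A h S = (SUP x\<in>A \<union> {x. \<exists>\<sigma>\<in>S. \<sigma> x \<noteq> 0}. h x)"

lemma height_class:
  assumes "\<sigma> \<in> cmsets UNIV"
  shows "height A h (diagram_rel A `` {\<sigma>}) = (SUP x\<in>A \<union> {x. \<sigma> x \<noteq> 0}. h x)"
proof -
  have "\<sigma> x \<noteq> 0 \<or> x \<in> A" if \<tau>: "\<tau> \<in> diagram_rel A `` {\<sigma>}" "\<tau> x \<noteq> 0" for \<tau> x
  proof -
    obtain \<alpha> \<beta> where "\<alpha> \<in> cmsets A" "\<sigma> \<oplus>\<^sub>m \<alpha> = \<tau> \<oplus>\<^sub>m \<beta>"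
      using \<tau>(1) unfolding diagram_rel_def by blast
    then have "\<sigma> x + \<alpha> x \<noteq> 0" "\<alpha> x \<noteq> 0 \<longrightarrow> x \<in> A"
      using \<tau>(2) by (auto simp: cm_add_def fun_eq_iff cmsets_def)
    then show ?thesis by auto
  qed
  moreover have "\<sigma> \<in> diagram_rel A `` {\<sigma>}"
    using refl_diagram_rel[OF assms] by blast
  ultimately have "A \<union> {x. \<exists>\<tau>\<in>diagram_rel A `` {\<sigma>}. \<tau> x \<noteq> 0} = A \<union> {x. \<sigma> x \<noteq> 0}"
    by blast
  then show ?thesis by (simp add: height_def)
qed

text \<open>If \<open>h\<close> vanishes on \<open>A\<close>, then its supremum is not affected by the added points of \<open>A\<close>, and a
  matching of cost \<open>c\<close> moves each single point by at most \<open>c\<close>. This is how coordinate functions on the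
  space of all diagrams arise from functions on the underlying space.\<close>

lemma height_le_add:
  assumes p: "0 < p" and A: "A \<noteq> {}" and lip: "\<And>x y. h x \<le> h y + dist x y"
    and bdd: "\<And>x. h x \<le> K" and vanish: "\<And>x. x \<in> A \<Longrightarrow> h x = 0"
    and S: "S \<in> diagrams A" and T: "T \<in> diagrams A"
    and c: "0 \<le> c" "diagram_dist p A S T < ennreal c"
  shows "height A h S \<le> height A h T + c"
proof -
  obtain \<sigma> \<tau> where \<sigma>: "\<sigma> \<in> cmsets UNIV" "S = diagram_rel A `` {\<sigma>}"
    and \<tau>: "\<tau> \<in> cmsets UNIV" "T = diagram_rel A `` {\<tau>}"
    using S T by (elim diagrams_rep) (rule that)
  have up: "h y \<le> height A h T" if "y \<in> A \<union> {x. \<tau> x \<noteq> 0}" for y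
    unfolding \<tau>(2) height_class[OF \<tau>(1)] using that bdd by (intro cSUP_upper bdd_aboveI2)
  obtain \<alpha> \<beta> where ab: "\<alpha> \<in> cmsets A" "\<beta> \<in> cmsets A" "matching p c (\<sigma> \<oplus>\<^sub>m \<alpha>) (\<tau> \<oplus>\<^sub>m \<beta>)"
    using matching_of_diagram_dist_less[OF p c(1) \<sigma>(1) \<tau>(1)] c(2) \<sigma>(2) \<tau>(2) by metis
  obtain \<phi> where \<phi>: "bij_betw \<phi> (cm_points (\<sigma> \<oplus>\<^sub>m \<alpha>)) (cm_points (\<tau> \<oplus>\<^sub>m \<beta>))"
    "matching_cost p (\<sigma> \<oplus>\<^sub>m \<alpha>) \<phi> \<le> ennreal (c powr p)"
    using ab(3) by (auto simp: matching_def)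
  have "h x \<le> height A h T + c" if "x \<in> A \<union> {x. \<sigma> x \<noteq> 0}" for x
  proof (cases "x \<in> A")
    case True
    then show ?thesis using up[of x] vanish c(1) by simp
  next
    case False
    then have x: "(x, 0) \<in> cm_points (\<sigma> \<oplus>\<^sub>m \<alpha>)"
      using that by (auto simp: cm_points_def cm_add_def zero_enat_def[symmetric] zero_less_iff_neq_zero)
    obtain y j where y: "\<phi> (x, 0) = (y, j)" by fastforce
    have "(y, j) \<in> cm_points (\<tau> \<oplus>\<^sub>m \<beta>)" using bij_betwE[OF \<phi>(1)] x y by metis
    then have "\<tau> y + \<beta> y \<noteq> 0" by (auto simp: cm_points_def cm_add_def)
    then have "y \<in> A \<union> {x. \<tau> x \<noteq> 0}" using ab(2) by (auto simp: cmsets_def)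
    moreover have "dist x y \<le> c"
      using matching_single_dist[OF p c(1) \<phi> x] y by simp
    ultimately show ?thesis using up[of y] lip[of x y] by linarith
  qed
  then show ?thesis
    unfolding \<sigma>(2) height_class[OF \<sigma>(1)] using A by (intro cSUP_least) auto
qed

lemma height_lipschitz:
  assumes p: "1 \<le> p" and A: "A \<noteq> {}" and lip: "\<And>x y. h x \<le> h y + dist x y"
    and bdd: "\<And>x. h x \<le> K" and vanish: "\<And>x. x \<in> A \<Longrightarrow> h x = 0"
    and S: "S \<in> pdiagrams p A" and T: "T \<in> pdiagrams p A"
  shows "\<bar>height A h S - height A h T\<bar> \<le> pdiagram_dist p A S T"
proof -
  have p0: "0 < p" using p by simp
  have le: "height A h S \<le> height A h T + pdiagram_dist p A S T"
    if S: "S \<in> pdiagrams p A" and T: "T \<in> pdiagrams p A" for S T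
  proof (rule field_le_epsilon)
    fix e :: real assume e: "0 < e"
    have "diagram_dist p A S T = ennreal (pdiagram_dist p A S T)" "0 \<le> pdiagram_dist p A S T"
      using diagram_dist_finite[OF p S T] by (simp_all add: pdiagram_dist_def)
    then have "diagram_dist p A S T < ennreal (pdiagram_dist p A S T + e)" "0 \<le> pdiagram_dist p A S T + e"
      using e by (simp_all add: ennreal_less_iff)
    then have "height A h S \<le> height A h T + (pdiagram_dist p A S T + e)"
      using S T by (intro height_le_add[OF p0 A lip bdd vanish]) (auto simp: pdiagrams_def)
    then show "height A h S \<le> height A h T + pdiagram_dist p A S T + e" by simp
  qed
  have "pdiagram_dist p A T S = pdiagram_dist p A S T"
    unfolding pdiagram_dist_def by (subst diagram_dist_commute[OF p0]) (rule refl)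
  then show ?thesis using le[OF S T] le[OF T S] by linarith
qed

definition cm_family :: "nat \<Rightarrow> (nat \<Rightarrow> 'a) \<Rightarrow> 'a cmset" where
  "cm_family k a = (\<lambda>x. if x \<in> a ` {..<k} then 1 else 0)"

lemma cm_family_in: "a ` {..<k} \<subseteq> A \<Longrightarrow> cm_family k a \<in> cmsets A"
  by (auto simp: cmsets_def cm_family_def)

lemma bij_betw_cm_family:
  "inj_on a {..<k} \<Longrightarrow> bij_betw (\<lambda>i. (a i, 0)) {..<k} (cm_points (cm_family k a))"
  by (auto simp: bij_betw_def inj_on_def cm_points_def cm_family_def one_enat_def split: if_splits)

text \<open>The crude factor \<open>k\<close> stands for \<open>k powr (1 / p)\<close> and keeps the bound independent of \<open>p\<close>.\<close>

lemma matching_cm_family: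
  assumes p: "1 \<le> p" and k: "0 < k" and inj: "inj_on a {..<k}" "inj_on b {..<k}"
    and \<eta>: "0 \<le> \<eta>" "\<And>i. i < k \<Longrightarrow> dist (a i) (b i) \<le> \<eta>"
  shows "matching p (real k * \<eta>) (cm_family k a) (cm_family k b)"
proof -
  note a = bij_betw_cm_family[OF inj(1)] and b = bij_betw_cm_family[OF inj(2)]
  let ?a = "\<lambda>i. (a i, 0 :: nat)" and ?b = "\<lambda>i. (b i, 0 :: nat)"
  define \<phi> where "\<phi> = ?b \<circ> inv_into {..<k} ?a"
  have "bij_betw \<phi> (cm_points (cm_family k a)) (cm_points (cm_family k b))"
    unfolding \<phi>_def by (rule bij_betw_trans[OF bij_betw_inv_into[OF a] b])
  moreover have "matching_cost p (cm_family k a) \<phi> \<le> ennreal ((real k * \<eta>) powr p)"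
  proof -
    have "matching_cost p (cm_family k a) \<phi> =
        (\<Sum>\<^sub>\<infinity>i\<in>{..<k}. ennreal (dist (fst (?a i)) (fst (\<phi> (?a i))) powr p))"
      unfolding matching_cost_def by (rule infsum_reindex_bij_betw[OF a, symmetric])
    also have "\<dots> = (\<Sum>i<k. ennreal (dist (a i) (b i) powr p))"
      using bij_betw_inv_into_left[OF a] by (simp add: \<phi>_def)
    also have "\<dots> \<le> (\<Sum>i<k. ennreal (\<eta> powr p))"
      using p \<eta> by (intro sum_mono ennreal_leI powr_mono2) auto
    also have "\<dots> = ennreal (real k * \<eta> powr p)"
      by (simp add: ennreal_mult ennreal_of_nat_eq_real_of_nat)
    also have "\<dots> \<le> ennreal (real k powr p * \<eta> powr p)"
      using p k powr_mono[of 1 p "real k"] by (intro ennreal_leI mult_right_mono) auto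
    also have "\<dots> = ennreal ((real k * \<eta>) powr p)"
      using \<eta> by (simp add: powr_mult)
    finally show ?thesis .
  qed
  ultimately show ?thesis unfolding matching_def by blast
qed

lemma cm_add_empty [simp]: "\<sigma> \<oplus>\<^sub>m cm_empty = \<sigma>" "cm_empty \<oplus>\<^sub>m \<sigma> = \<sigma>"
  by (simp_all add: cm_add_def cm_empty_def)

text \<open>A point of the cube becomes a diagram of \<open>k\<close> points that slide along one ray leaving the
  diagonal. The \<open>i\<close>-th point stays within \<open>L\<close> of its centre \<open>ray (c i)\<close>, at distance \<open>L - t i\<close>, and the
  tent \<open>h i\<close> of height \<open>2 * L\<close> around that centre reads off \<open>L + t i\<close>. The spacing \<open>4 * L\<close> of the centres
  keeps the other points and the diagonal outside the support of the tent.\<close>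

lemma ex_lipschitz_cube:
  assumes p: "1 \<le> p" and k: "0 < k" and L: "0 < L"
  shows "\<exists>f g. lipschitz_cube (pdiagrams p (diagonal :: ('v::euclidean_space \<times> 'v) set))
    (pdiagram_dist p diagonal) k L f g"
proof -
  let ?\<Delta> = "diagonal :: ('v \<times> 'v) set"
  have p0: "0 < p" using p by simp
  obtain u :: 'v where u: "norm u = 1" using nonempty_Basis norm_Basis by blast
  define ray :: "real \<Rightarrow> 'v \<times> 'v" where "ray a = (0, a *\<^sub>R u)" for a
  have dist_ray: "dist (ray a) (ray b) = \<bar>a - b\<bar>" for a b
    using u by (simp add: ray_def dist_Pair_Pair dist_norm flip: scaleR_left_diff_distrib)
  have dist_diag: "a \<le> 2 * dist x (ray a)" if "x \<in> ?\<Delta>" for x a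
  proof -
    obtain v where x: "x = (v, v)" using \<open>x \<in> ?\<Delta>\<close> by (auto simp: diagonal_def)
    have "a \<le> norm (a *\<^sub>R u)" using u by simp
    also have "\<dots> \<le> dist 0 v + dist v (a *\<^sub>R u)"
      using dist_triangle[of 0 "a *\<^sub>R u" v] by (simp add: dist_norm)
    also have "\<dots> \<le> dist x (ray a) + dist x (ray a)"
      using dist_fst_le[of x "ray a"] dist_snd_le[of x "ray a"]
      by (intro add_mono) (auto simp: x ray_def dist_commute)
    finally show ?thesis by simp
  qed
  define c where "c i = 4 * L * (real i + 1)" for i :: nat
  define q where "q t i = ray (c i + (L - t i))" for t i
  define h where "h i x = max 0 (2 * L - dist x (ray (c i)))" for i x
  define f where "f t = diagram_rel ?\<Delta> `` {cm_family k (q t)}" for t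
  define g where "g i S = height ?\<Delta> (h i) S - L" for i S
  have c_far: "4 * L \<le> \<bar>c i - c j\<bar>" if "i \<noteq> j" for i j
  proof -
    have "1 \<le> \<bar>real i - real j\<bar>" using that by linarith
    then have "4 * L * 1 \<le> 4 * L * \<bar>real i - real j\<bar>" using L by (intro mult_left_mono) auto
    also have "\<dots> = \<bar>4 * L * (real i - real j)\<bar>" using L by (simp add: abs_mult)
    also have "4 * L * (real i - real j) = c i - c j" by (simp add: c_def algebra_simps)
    finally show ?thesis by simp
  qed
  have inj: "inj_on (q t) {..<k}" if t: "t \<in> cube k L" for t
  proof (rule inj_onI, rule ccontr)
    fix i j assume ij: "i \<in> {..<k}" "j \<in> {..<k}" "q t i = q t j" "i \<noteq> j"
    then have "\<bar>(c i + (L - t i)) - (c j + (L - t j))\<bar> = 0"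
      using dist_ray[of "c i + (L - t i)" "c j + (L - t j)"] by (simp add: q_def)
    moreover have "0 \<le> t i" "t i \<le> L" "0 \<le> t j" "t j \<le> L" using t ij by (auto simp: cube_def)
    ultimately show False using c_far[OF ij(4)] L by linarith
  qed
  have in_UNIV: "cm_family k (q t) \<in> cmsets UNIV" for t by (intro cm_family_in) simp
  have h_diag: "h i x = 0" if "x \<in> ?\<Delta>" for i x
  proof -
    have "4 * L * 1 \<le> c i" unfolding c_def using L by (intro mult_left_mono) auto
    then show ?thesis using dist_diag[OF that, of "c i"] by (simp add: h_def)
  qed
  have h_lip: "h i x \<le> h i y + dist x y" for i x y
    using dist_triangle[of y "ray (c i)" x] by (auto simp: h_def dist_commute)
  have h_bdd: "h i x \<le> 2 * L" for i x using L by (simp add: h_def)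
  have h_q: "h i (q t j) = (if i = j then L + t i else 0)" if t: "t \<in> cube k L" "i < k" "j < k" for t i j
  proof (cases "i = j")
    case True
    then show ?thesis using t L by (simp add: h_def q_def dist_ray cube_def)
  next
    case False
    have "0 \<le> t j" "t j \<le> L" using t by (auto simp: cube_def)
    then show ?thesis using c_far[OF False] L False by (simp add: h_def q_def dist_ray)
  qed
  have diag_ne: "?\<Delta> \<noteq> {}" by (auto simp: diagonal_def)
  have "lipschitz_cube (pdiagrams p ?\<Delta>) (pdiagram_dist p ?\<Delta>) k L f g"
  proof
    fix t assume t: "t \<in> cube k L"
    \<comment> \<open>Any \<open>k\<close> different points of the diagonal serve as partners in a matching of finite cost.\<close>
    define b where "b i = (real i *\<^sub>R u, real i *\<^sub>R u)" for i
    have b: "b ` {..<k} \<subseteq> ?\<Delta>" by (auto simp: b_def diagonal_def)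
    have "inj_on b {..<k}" using u by (auto simp: b_def inj_on_def)
    then have "matching p (real k * (\<Sum>i<k. dist (q t i) (b i))) (cm_family k (q t)) (cm_family k b)"
      using inj[OF t] by (intro matching_cm_family[OF p k]) (auto intro: sum_nonneg member_le_sum)
    then have "diagram_dist p ?\<Delta> (f t) (empty_diagram ?\<Delta>) \<le> ennreal (real k * (\<Sum>i<k. dist (q t i) (b i)))"
      unfolding f_def empty_diagram_def using p0 b
      by (intro diagram_dist_le[where \<alpha> = cm_empty and \<beta> = "cm_family k b"] in_UNIV cm_empty_in cm_family_in)
        (auto intro!: mult_nonneg_nonneg sum_nonneg)
    also have "\<dots> < \<infinity>" by simp
    finally show "f t \<in> pdiagrams p ?\<Delta>"
      using in_UNIV by (simp add: pdiagrams_def diagrams_def f_def quotientI)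
  next
    fix s t and \<eta> :: real
    assume st: "s \<in> cube k L" "t \<in> cube k L" and \<eta>: "\<And>i. i < k \<Longrightarrow> \<bar>s i - t i\<bar> \<le> \<eta>"
    have \<eta>0: "0 \<le> \<eta>" using \<eta>[OF k] by linarith
    have "dist (q s i) (q t i) \<le> \<eta>" if "i < k" for i
      using \<eta>[OF that] by (simp add: q_def dist_ray abs_minus_commute)
    then have "matching p (real k * \<eta>) (cm_family k (q s)) (cm_family k (q t))"
      using inj st \<eta>0 by (intro matching_cm_family[OF p k]) auto
    then have "diagram_dist p ?\<Delta> (f s) (f t) \<le> ennreal (real k * \<eta>)"
      unfolding f_def using p0 \<eta>0
      by (intro diagram_dist_le[where \<alpha> = cm_empty and \<beta> = cm_empty] in_UNIV cm_empty_in) auto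
    then show "pdiagram_dist p ?\<Delta> (f s) (f t) \<le> real k * \<eta>"
      unfolding pdiagram_dist_def using \<eta>0 by (intro enn2real_leI) auto
  next
    fix S T i assume "S \<in> pdiagrams p ?\<Delta>" "T \<in> pdiagrams p ?\<Delta>"
    then have "\<bar>height ?\<Delta> (h i) S - height ?\<Delta> (h i) T\<bar> \<le> pdiagram_dist p ?\<Delta> S T"
      by (intro height_lipschitz[OF p diag_ne h_lip h_bdd h_diag])
    then show "\<bar>g i S - g i T\<bar> \<le> pdiagram_dist p ?\<Delta> S T" by (simp add: g_def)
  next
    fix t i assume t: "t \<in> cube k L" and i: "i < k"
    have ti: "0 \<le> t i" using t i by (simp add: cube_def)
    have supp: "{x. cm_family k (q t) x \<noteq> 0} = q t ` {..<k}" by (auto simp: cm_family_def)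
    have "(SUP x\<in>?\<Delta> \<union> q t ` {..<k}. h i x) = L + t i"
    proof (rule antisym)
      show "(SUP x\<in>?\<Delta> \<union> q t ` {..<k}. h i x) \<le> L + t i"
      proof (rule cSUP_least)
        fix x assume "x \<in> ?\<Delta> \<union> q t ` {..<k}"
        then show "h i x \<le> L + t i"
          using h_diag[of x i] h_q[OF t i] L ti by auto
      qed (use diag_ne in simp)
      have "h i (q t i) \<le> (SUP x\<in>?\<Delta> \<union> q t ` {..<k}. h i x)"
        using i h_bdd[of i] by (intro cSUP_upper bdd_aboveI2) auto
      then show "L + t i \<le> (SUP x\<in>?\<Delta> \<union> q t ` {..<k}. h i x)"
        using h_q[OF t i i] by simp
    qed
    then show "g i (f t) = t i"
      unfolding g_def f_def height_class[OF in_UNIV] supp by simp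
  qed (use k L in auto)
  then show ?thesis by blast
qed


section \<open>Infinite dimension\<close>

lemma closed_diagonal: "closed (diagonal :: ('v::t2_space \<times> 'v) set)"
proof -
  have eq: "(diagonal :: ('v \<times> 'v) set) = {x. fst x = snd x}" by (auto simp: diagonal_def)
  show ?thesis unfolding eq by (intro closed_Collect_eq continuous_intros)
qed

theorem theorem5:
  fixes p :: real
    and M :: "((real^'n) \<times> (real^'n)) cmset set set"
    and d :: "((real^'n) \<times> (real^'n)) cmset set \<Rightarrow> ((real^'n) \<times> (real^'n)) cmset set \<Rightarrow> real"
  assumes "1 \<le> p"
  defines "M \<equiv> pdiagrams p diagonal"
    and "d \<equiv> pdiagram_dist p diagonal"
  shows "covering_dim (Metric_space.mtopology M d) = \<infinity> \<and>
    hausdorff_dim M d = \<infinity> \<and>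
    asymptotic_dim M d = \<infinity> \<and>
    assouad_dim M d = \<infinity> \<and>
    assouad_nagata_dim M d = \<infinity>"
proof -
  have "(diagonal :: ((real^'n) \<times> (real^'n)) set) \<noteq> {}" by (auto simp: diagonal_def)
  then have metric: "Metric_space M d"
    unfolding M_def d_def using \<open>1 \<le> p\<close> closed_diagonal by (intro Metric_space_pdiagrams)
  have cubes: "\<exists>f g. lipschitz_cube M d k L f g" if "0 < k" "0 < L" for k L
    unfolding M_def d_def using \<open>1 \<le> p\<close> that by (rule ex_lipschitz_cube)
  show ?thesis
    using covering_dim_infinite[OF metric cubes] hausdorff_dim_infinite[OF cubes]
      asymptotic_dim_infinite[OF metric cubes] assouad_dim_infinite[OF metric cubes]
      assouad_nagata_dim_infinite[OF cubes] by blast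
qed

end
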